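(* Let $\mathbf A$ be an $\mathbb R$-quasi-torus, the kernel of a surjective homomorphism of $\mathbb R$-tori $j\colon\mathbf T\to\mathbf T'$. Then for every $k\in\mathbb Z$ there is a canonical isomorphism $$\vartheta^k\colon\mathbb H^k\big(\mathsf X_*(\mathbf T)\to\mathsf X_*(\mathbf T')\big)\xrightarrow{\ \sim\ }\mathrm H^{k+1}\mathbf A.$$
   Context: An $\mathbb R$-quasi-torus is an $\mathbb R$-group of multiplicative type (commutative algebraic $\mathbb R$-group all of whose complex points are semisimple). $\Gamma=\mathrm{Gal}(\mathbb C/\mathbb R)=\{1,\gamma\}$. For a $\Gamma$-module $A$ (additive) and $k\in\mathbb Z$, put $d^k a={}^\gamma a+(-1)^{k+1}a$ and $\mathrm H^kA=\ker d^k/\mathrm{im}\,d^{k-1}$ (Tate cohomology). For a commutative $\mathbb R$-group $\mathbf A$, $\mathrm H^k\mathbf A=\mathrm H^k(\mathbf A(\mathbb C))$. For a morphism of $\Gamma$-modules $\partial\colon A_1\to A_0$ (a short complex), put $D^k(a_1,a_0)=(-d^{k+1}a_1,\ d^ka_0-\partial a_1)$ on $A_1\oplus A_0$ and $\mathbb H^k(A_1\to A_0)=\ker D^k/\mathrm{im}\,D^{k-1}$; the class of $(a_1,a_0)$ is $[a_1,a_0]$. $\mathsf X_*(\mathbf T)=\mathrm{Hom}(\mathbb G_{m,\mathbb C},\mathbf T_{\mathbb C})$ with $({}^\gamma\nu)(z)={}^\gamma(\nu({}^{\gamma^{-1}}z))$; the map $\mathsf X_*(\mathbf T)\to\mathsf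 X_*(\mathbf T')$ is induced by $j$. The canonical map $\vartheta^k$ is the following: for a $k$-hypercocycle $(\nu,\nu')\in\mathsf X_*(\mathbf T)\oplus\mathsf X_*(\mathbf T')$, choose $t\in\mathbf T(\mathbb C)$ with $j(t)=\nu'(-1)$; then $\vartheta^k[\nu,\nu']=\big[\nu(-1)\cdot{}^\gamma t^{-1}\cdot t^{(-1)^k}\big]$. *)

theory Defs
  imports
    Complex_Main
    "HOL-Library.FuncSet"
    "HOL-Algebra.Coset"
    "Jordan_Normal_Form.Determinant"
begin

section \<open>Real algebraic groups\<close>

text \<open>
  A (linear) algebraic \<open>\<real>\<close>-group is given by its group of complex points, embedded in some
  \<open>GL\<^sub>n(\<complex>)\<close> as the zero locus of functions in \<open>\<real>[x\<^sub>i\<^sub>j, 1/det]\<close>; the nontrivial element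
  of \<open>Gal(\<complex>/\<real>)\<close> acts by conjugating the matrix entries.  Since the characteristic is 0, algebraic
  groups are reduced, so that nothing is lost by recording only the complex points.
\<close>

record 'a gamma_module = "'a monoid" +
  gal :: "'a \<Rightarrow> 'a"

definition complex_points :: "nat \<Rightarrow> complex mat set \<Rightarrow> complex mat gamma_module" where
  "complex_points n G = \<lparr>carrier = G, monoid.mult = (*), one = 1\<^sub>m n, gal = map_mat cnj\<rparr>"

definition GL :: "nat \<Rightarrow> complex mat set" where
  "GL n = {g \<in> carrier_mat n n. det g \<noteq> 0}"

text \<open>The \<open>K\<close>-algebra of functions generated by \<open>F\<close>, i.e. polynomials over \<open>K\<close> in members
  of \<open>F\<close>.\<close>

inductive_set generated_algebra ::
  "complex set \<Rightarrow> ('a \<Rightarrow> complex) set \<Rightarrow> ('a \<Rightarrow> complex) set"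
  for K :: "complex set" and F :: "('a \<Rightarrow> complex) set" where
  const: "c \<in> K \<Longrightarrow> (\<lambda>_. c) \<in> generated_algebra K F"
| gen: "f \<in> F \<Longrightarrow> f \<in> generated_algebra K F"
| add: "f \<in> generated_algebra K F \<Longrightarrow> g \<in> generated_algebra K F
    \<Longrightarrow> (\<lambda>x. f x + g x) \<in> generated_algebra K F"
| mult: "f \<in> generated_algebra K F \<Longrightarrow> g \<in> generated_algebra K F
    \<Longrightarrow> (\<lambda>x. f x * g x) \<in> generated_algebra K F"

definition regular_GL :: "complex set \<Rightarrow> nat \<Rightarrow> (complex mat \<Rightarrow> complex) set" where
  "regular_GL K n = generated_algebra K
     (insert (\<lambda>g. inverse (det g)) {\<lambda>g. g $$ (i, j) |i j. i < n \<and> j < n})"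

definition real_group :: "nat \<Rightarrow> complex mat set \<Rightarrow> bool" where
  "real_group n G \<longleftrightarrow>
     subgroup G (complex_points n (GL n)) \<and>
     (\<exists>S \<subseteq> regular_GL \<real> n. G = {g \<in> GL n. \<forall>p\<in>S. p g = 0})"

text \<open>Homomorphisms defined over the subfield \<open>K\<close> of \<open>\<complex>\<close>.  Regularity of \<open>1 / det (f g)\<close> need
  not be required: it equals \<open>det (f (g\<^sup>-\<^sup>1))\<close>.\<close>

definition alg_hom ::
  "complex set \<Rightarrow> nat \<Rightarrow> complex mat set \<Rightarrow> nat \<Rightarrow> complex mat set \<Rightarrow> (complex mat \<Rightarrow> complex mat) set"
  where
  "alg_hom K n G m H = {f \<in> hom (complex_points n G) (complex_points m H).
     \<forall>i<m. \<forall>j<m. \<exists>p \<in> regular_GL K n. \<forall>g\<in>G. f g $$ (i, j) = p g}"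

definition diag_torus :: "nat \<Rightarrow> complex mat set" where
  "diag_torus d = {g \<in> GL d. diagonal_mat g}"

definition real_torus :: "nat \<Rightarrow> complex mat set \<Rightarrow> bool" where
  "real_torus n T \<longleftrightarrow> real_group n T \<and>
     (\<exists>d. \<exists>f \<in> alg_hom UNIV n T d (diag_torus d). \<exists>h \<in> alg_hom UNIV d (diag_torus d) n T.
        (\<forall>t\<in>T. h (f t) = t) \<and> (\<forall>s\<in>diag_torus d. f (h s) = s))"

text \<open>Over \<open>\<complex>\<close> a matrix is semisimple iff it is diagonalizable.\<close>

definition semisimple_mat :: "complex mat \<Rightarrow> bool" where
  "semisimple_mat g \<longleftrightarrow> (\<exists>D. diagonal_mat D \<and> similar_mat g D)"

definition real_quasi_torus :: "nat \<Rightarrow> complex mat set \<Rightarrow> bool" where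
  "real_quasi_torus n A \<longleftrightarrow>
     real_group n A \<and> comm_group (complex_points n A) \<and> (\<forall>a\<in>A. semisimple_mat a)"

section \<open>Cocharacters\<close>

definition Gm :: "complex monoid" where
  "Gm = \<lparr>carrier = - {0}, monoid.mult = (*), one = 1\<rparr>"

text \<open>Homomorphisms \<open>G\<^sub>m \<rightarrow> T\<close> over \<open>\<complex>\<close>: the entries are Laurent polynomials.  The value at 0
  is fixed by extensionality.\<close>

definition cocharacters :: "nat \<Rightarrow> complex mat set \<Rightarrow> (complex \<Rightarrow> complex mat) set" where
  "cocharacters n T = {\<nu> \<in> hom Gm (complex_points n T) \<inter> extensional (carrier Gm).
     \<forall>i<n. \<forall>j<n. \<exists>p \<in> generated_algebra UNIV {\<lambda>z. z, inverse}.
        \<forall>z \<in> carrier Gm. \<nu> z $$ (i, j) = p z}"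

definition cochar_module ::
  "nat \<Rightarrow> complex mat set \<Rightarrow> (complex \<Rightarrow> complex mat) gamma_module" where
  "cochar_module n T =
    \<lparr>carrier = cocharacters n T,
     monoid.mult = (\<lambda>\<mu> \<nu>. \<lambda>z\<in>carrier Gm. \<mu> z * \<nu> z),
     one = (\<lambda>z\<in>carrier Gm. 1\<^sub>m n),
     gal = (\<lambda>\<nu>. \<lambda>z\<in>carrier Gm. map_mat cnj (\<nu> (cnj z)))\<rparr>"

definition cochar_map ::
  "(complex mat \<Rightarrow> complex mat) \<Rightarrow> (complex \<Rightarrow> complex mat) \<Rightarrow> (complex \<Rightarrow> complex mat)" where
  "cochar_map j \<nu> = compose (carrier Gm) j \<nu>"

section \<open>Tate cohomology and hypercohomology\<close>

text \<open>All modules are written multiplicatively.\<close>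

definition neg_one_power :: "int \<Rightarrow> int" where
  "neg_one_power k = (if even k then 1 else - 1)"

definition tate_d :: "('a, 'b) gamma_module_scheme \<Rightarrow> int \<Rightarrow> 'a \<Rightarrow> 'a" where
  "tate_d A k a = gal A a \<otimes>\<^bsub>A\<^esub> (a [^]\<^bsub>A\<^esub> neg_one_power (k + 1))"

text \<open>The short complex \<open>A1 \<rightarrow> A0\<close> has \<open>A0\<close> in degree 0 and \<open>A1\<close> in degree -1.\<close>

definition hyper_D ::
  "('a, 'c) gamma_module_scheme \<Rightarrow> ('b, 'd) gamma_module_scheme \<Rightarrow> ('a \<Rightarrow> 'b) \<Rightarrow> int
    \<Rightarrow> 'a \<times> 'b \<Rightarrow> 'a \<times> 'b" where
  "hyper_D A1 A0 \<phi> k = (\<lambda>(a1, a0).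
     (inv\<^bsub>A1\<^esub> (tate_d A1 (k + 1) a1), tate_d A0 k a0 \<otimes>\<^bsub>A0\<^esub> inv\<^bsub>A0\<^esub> (\<phi> a1)))"

text \<open>Cohomology of a complex all of whose terms are the same group \<open>C\<close>, with differentials
  \<open>D k\<close> from degree \<open>k\<close> to degree \<open>k + 1\<close>.\<close>

definition cocycles :: "('a, 'b) monoid_scheme \<Rightarrow> (int \<Rightarrow> 'a \<Rightarrow> 'a) \<Rightarrow> int \<Rightarrow> 'a set" where
  "cocycles C D k = kernel C C (D k)"

definition coboundaries :: "('a, 'b) monoid_scheme \<Rightarrow> (int \<Rightarrow> 'a \<Rightarrow> 'a) \<Rightarrow> int \<Rightarrow> 'a set" where
  "coboundaries C D k = D (k - 1) ` carrier C"

definition cohomology ::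
  "('a, 'b) monoid_scheme \<Rightarrow> (int \<Rightarrow> 'a \<Rightarrow> 'a) \<Rightarrow> int \<Rightarrow> 'a set monoid" where
  "cohomology C D k = C\<lparr>carrier := cocycles C D k\<rparr> Mod coboundaries C D k"

definition cohomology_class ::
  "('a, 'b) monoid_scheme \<Rightarrow> (int \<Rightarrow> 'a \<Rightarrow> 'a) \<Rightarrow> int \<Rightarrow> 'a \<Rightarrow> 'a set" where
  "cohomology_class C D k x = coboundaries C D k #>\<^bsub>C\<^esub> x"

abbreviation tate_cocycles :: "('a, 'b) gamma_module_scheme \<Rightarrow> int \<Rightarrow> 'a set" where
  "tate_cocycles A k \<equiv> cocycles A (tate_d A) k"

abbreviation tate_cohomology :: "('a, 'b) gamma_module_scheme \<Rightarrow> int \<Rightarrow> 'a set monoid" where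
  "tate_cohomology A k \<equiv> cohomology A (tate_d A) k"

abbreviation tate_class :: "('a, 'b) gamma_module_scheme \<Rightarrow> int \<Rightarrow> 'a \<Rightarrow> 'a set" where
  "tate_class A k x \<equiv> cohomology_class A (tate_d A) k x"

abbreviation hypercocycles ::
  "('a, 'c) gamma_module_scheme \<Rightarrow> ('b, 'd) gamma_module_scheme \<Rightarrow> ('a \<Rightarrow> 'b) \<Rightarrow> int
    \<Rightarrow> ('a \<times> 'b) set" where
  "hypercocycles A1 A0 \<phi> k \<equiv> cocycles (A1 \<times>\<times> A0) (hyper_D A1 A0 \<phi>) k"

abbreviation hypercohomology ::
  "('a, 'c) gamma_module_scheme \<Rightarrow> ('b, 'd) gamma_module_scheme \<Rightarrow> ('a \<Rightarrow> 'b) \<Rightarrow> int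
    \<Rightarrow> ('a \<times> 'b) set monoid" where
  "hypercohomology A1 A0 \<phi> k \<equiv> cohomology (A1 \<times>\<times> A0) (hyper_D A1 A0 \<phi>) k"

abbreviation hyper_class ::
  "('a, 'c) gamma_module_scheme \<Rightarrow> ('b, 'd) gamma_module_scheme \<Rightarrow> ('a \<Rightarrow> 'b) \<Rightarrow> int
    \<Rightarrow> 'a \<times> 'b \<Rightarrow> ('a \<times> 'b) set" where
  "hyper_class A1 A0 \<phi> k x \<equiv> cohomology_class (A1 \<times>\<times> A0) (hyper_D A1 A0 \<phi>) k x"

definition theta_value ::
  "('a, 'b) gamma_module_scheme \<Rightarrow> int \<Rightarrow> (complex \<Rightarrow> 'a) \<Rightarrow> 'a \<Rightarrow> 'a" where
  "theta_value T k \<nu> t =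
     \<nu> (- 1) \<otimes>\<^bsub>T\<^esub> inv\<^bsub>T\<^esub> (gal T t) \<otimes>\<^bsub>T\<^esub> (t [^]\<^bsub>T\<^esub> neg_one_power k)"

end

theory Submission
  imports Defs "HOL-Analysis.Complex_Transcendental"
begin

text \<open>
  Let \<open>\<epsilon> = (-1)\<^sup>k\<close> and \<open>X = X\<^sub>*(T)\<close>; groups are written additively.  The theorem is a
  consequence of the exponential sequence of a torus, normalised so that the Galois action on
  periods can be read off.

  Let \<open>V\<close> be the group of one-parameter subgroups of \<open>T\<close>, that is, of holomorphic homomorphisms
  \<open>\<phi> : \<complex> \<rightarrow> T\<close>, with \<open>\<gamma>\<close> acting by \<open>(\<gamma>\<phi>)(z) = \<gamma>(\<phi>(cnj z))\<close>.  It is a complex vector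
  space (rescale the argument), it contains \<open>X\<close> through \<open>\<iota> \<nu> = (z \<mapsto> \<nu>(exp(\<pi>iz)))\<close>, and it maps to
  \<open>T\<close> by \<open>\<phi> \<mapsto> \<phi>(1)\<close>.  Four facts are used.
  \<^item> Evaluation at \<open>1\<close> is onto, and its kernel is exactly \<open>2\<iota>X\<close>.
  \<^item> \<open>\<iota>(\<nu>)(1) = \<nu>(-1)\<close>.
  \<^item> \<open>V\<close> is uniquely 2-divisible, so that it has no Tate cohomology.
  \<^item> \<open>\<gamma>\<iota> = -\<iota>\<gamma>\<close>, because complex conjugation turns \<open>exp(\<pi>iz)\<close> into \<open>exp(-\<pi>i cnj z)\<close>.

  Hence \<open>0 \<rightarrow> X(1) \<rightarrow> V \<rightarrow> T \<rightarrow> 0\<close> is exact, where \<open>X(1)\<close> is \<open>X\<close> with the opposite action, and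
  likewise for \<open>T'\<close>.  As \<open>j\<close> is onto, \<open>A[1]\<close> is quasi-isomorphic to the complex \<open>T \<rightarrow> T'\<close>; as
  \<open>V \<rightarrow> V'\<close> contributes nothing, the cohomology of \<open>T \<rightarrow> T'\<close> in degree \<open>k\<close> is that of
  \<open>X(1) \<rightarrow> X'(1)\<close> in degree \<open>k + 1\<close>, and the sign twist moves it back to degree \<open>k\<close> of \<open>X \<rightarrow> X'\<close>.
  The map \<open>\<theta>\<close> of the theorem is the composite.  It is shown directly on cocycles to be
  well defined (\<open>theta_cocycle\<close>, \<open>theta_change_lift\<close>, \<open>theta_coboundary\<close>), injective (\<open>theta_injective\<close>) and surjective
  (\<open>theta_surjective\<close>), using only the facts above.

  Those facts are obtained for matrix groups as follows.  A torus is identified with a group of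
  diagonal matrices by an isomorphism over \<open>\<complex>\<close>; composing with algebraic homomorphisms preserves
  both cocharacters and one-parameter subgroups.  So it suffices to treat \<open>\<complex>\<^sup>*\<close>, where a holomorphic
  homomorphism \<open>\<complex> \<rightarrow> \<complex>\<^sup>*\<close> is \<open>z \<mapsto> exp(cz)\<close>, and is trivial at \<open>1\<close> only if it is an integral power
  of \<open>exp(2\<pi>iz)\<close>, which is where the cocharacter comes from.
\<close>

section \<open>Fractions in commutative groups\<close>

text \<open>
  A name for \<open>a \<otimes> inv b\<close>, so that the simplifier can treat it as a fraction.  With the rules
  \<open>group_fractions\<close> an identity between words in a commutative group is brought to the form
  \<open>a \<otimes> \<dots> = b \<otimes> \<dots>\<close> without inverses, which \<open>m_ac\<close> decides.
\<close>

definition quot :: "('a,'b) monoid_scheme \<Rightarrow> 'a \<Rightarrow> 'a \<Rightarrow> 'a" where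
  "quot G a b = a \<otimes>\<^bsub>G\<^esub> inv\<^bsub>G\<^esub> b"

context comm_group
begin

lemma quot_closed:
  "\<lbrakk>a \<in> carrier G; b \<in> carrier G\<rbrakk> \<Longrightarrow> quot G a b \<in> carrier G"
  by (simp add: quot_def)

lemma inv_quot: "a \<in> carrier G \<Longrightarrow> inv a = quot G \<one> a"
  by (simp add: quot_def)

lemma mult_quot:
  "\<lbrakk>a \<in> carrier G; b \<in> carrier G; c \<in> carrier G\<rbrakk>
    \<Longrightarrow> a \<otimes> quot G b c = quot G (a \<otimes> b) c"
  "\<lbrakk>a \<in> carrier G; b \<in> carrier G; c \<in> carrier G\<rbrakk>
    \<Longrightarrow> quot G b c \<otimes> a = quot G (a \<otimes> b) c"
  by (simp_all add: quot_def m_ac)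

lemma quot_quot:
  "\<lbrakk>a \<in> carrier G; b \<in> carrier G; c \<in> carrier G\<rbrakk>
    \<Longrightarrow> quot G (quot G a b) c = quot G a (b \<otimes> c)"
  "\<lbrakk>a \<in> carrier G; b \<in> carrier G; c \<in> carrier G\<rbrakk>
    \<Longrightarrow> quot G a (quot G b c) = quot G (a \<otimes> c) b"
  by (simp_all add: quot_def m_ac inv_mult)

lemma quot_eq_iff:
  "\<lbrakk>a \<in> carrier G; b \<in> carrier G; c \<in> carrier G\<rbrakk>
    \<Longrightarrow> quot G a b = c \<longleftrightarrow> a = c \<otimes> b"
  "\<lbrakk>a \<in> carrier G; b \<in> carrier G; c \<in> carrier G\<rbrakk>
    \<Longrightarrow> c = quot G a b \<longleftrightarrow> c \<otimes> b = a"
  by (metis inv_solve_right quot_def)+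

lemmas group_fractions = quot_closed inv_quot mult_quot
  quot_quot quot_eq_iff

end

section \<open>Complexes with constant terms\<close>

locale cochain_complex = comm_group C for C :: "('a, 'b) monoid_scheme" (structure) +
  fixes D :: "int \<Rightarrow> 'a \<Rightarrow> 'a"
  assumes D_hom: "D i \<in> hom C C"
    and D_D: "a \<in> carrier C \<Longrightarrow> D i (D (i - 1) a) = \<one>"
begin

lemma D_group_hom: "group_hom C C (D i)"
  using D_hom by (simp add: group_hom_def group_hom_axioms_def is_group)

lemma D_closed [simp]: "a \<in> carrier C \<Longrightarrow> D i a \<in> carrier C"
  using D_hom by (auto simp: hom_def)

lemma mem_cocycles_iff: "a \<in> cocycles C D i \<longleftrightarrow> a \<in> carrier C \<and> D i a = \<one>"
  by (simp add: cocycles_def kernel_def)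

lemma subgroup_cocycles: "subgroup (cocycles C D i) C"
  unfolding cocycles_def by (rule group_hom.subgroup_kernel[OF D_group_hom])

lemma subgroup_coboundaries: "subgroup (coboundaries C D i) C"
  unfolding coboundaries_def by (rule group_hom.img_is_subgroup[OF D_group_hom])

lemma coboundaries_subset: "coboundaries C D i \<subseteq> cocycles C D i"
  by (auto simp: coboundaries_def mem_cocycles_iff D_D)

lemma comm_group_cocycles: "comm_group (C\<lparr>carrier := cocycles C D i\<rparr>)"
proof (rule group.group_comm_groupI)
  show "group (C\<lparr>carrier := cocycles C D i\<rparr>)"
    by (rule subgroup.subgroup_is_group[OF subgroup_cocycles is_group])
qed (simp add: mem_cocycles_iff m_comm)

lemma normal_coboundaries: "coboundaries C D i \<lhd> C\<lparr>carrier := cocycles C D i\<rparr>"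
  using comm_group.subgroup_imp_normal[OF comm_group_cocycles]
    subgroup_incl[OF subgroup_coboundaries subgroup_cocycles coboundaries_subset] by blast

lemma group_cohomology: "group (cohomology C D i)"
  unfolding cohomology_def by (rule normal.factorgroup_is_group[OF normal_coboundaries])

lemma cohomology_class_eq:
  "cohomology_class C D i x = coboundaries C D i #>\<^bsub>C\<lparr>carrier := cocycles C D i\<rparr>\<^esub> x"
  by (simp add: cohomology_class_def r_coset_def)

lemma carrier_cohomology:
  "carrier (cohomology C D i) = cohomology_class C D i ` cocycles C D i"
  by (auto simp: cohomology_def FactGroup_def RCOSETS_def cohomology_class_eq)

lemma cohomology_class_mult:
  assumes "x \<in> cocycles C D i" "y \<in> cocycles C D i"
  shows "cohomology_class C D i (x \<otimes> y)
    = cohomology_class C D i x \<otimes>\<^bsub>cohomology C D i\<^esub> cohomology_class C D i y"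
  using normal.rcos_sum[OF normal_coboundaries, of x i y] assms
  by (simp add: cohomology_def FactGroup_def cohomology_class_eq)

lemma one_cohomology: "\<one>\<^bsub>cohomology C D i\<^esub> = coboundaries C D i"
  by (simp add: cohomology_def FactGroup_def)

lemma cohomology_class_eq_one_iff:
  assumes "x \<in> cocycles C D i"
  shows "cohomology_class C D i x = \<one>\<^bsub>cohomology C D i\<^esub> \<longleftrightarrow> x \<in> coboundaries C D i"
proof -
  have x: "x \<in> carrier C" using assms by (simp add: mem_cocycles_iff)
  show ?thesis
    unfolding one_cohomology cohomology_class_def
    using x coset_join1[OF _ x subgroup_coboundaries[of i]] coset_join2[OF x subgroup_coboundaries[of i]]
      subgroup.subset[OF subgroup_coboundaries[of i]] by blast
qed

lemma cohomology_class_cong: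
  assumes "x \<in> cocycles C D i" "y \<in> cocycles C D i" "x \<otimes> inv y \<in> coboundaries C D i"
  shows "cohomology_class C D i x = cohomology_class C D i y"
proof -
  have xy: "x \<in> carrier C" "y \<in> carrier C" using assms by (simp_all add: mem_cocycles_iff)
  have "x \<in> coboundaries C D i #> y"
    using assms(3) xy unfolding r_coset_def by (auto intro!: bexI[of _ "x \<otimes> inv y"] simp: m_assoc)
  then show ?thesis
    unfolding cohomology_class_def using repr_independence[OF _ xy(2) subgroup_coboundaries] by metis
qed

text \<open>
  The first isomorphism theorem for the cohomology of a complex, keeping track of what the
  isomorphism does to the class of a cocycle.
\<close>

lemma induced_iso:
  assumes H: "group H"
    and hom: "F \<in> hom (C\<lparr>carrier := cocycles C D i\<rparr>) H"
    and onto: "F ` cocycles C D i = carrier H"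
    and ker: "\<And>x. x \<in> cocycles C D i \<Longrightarrow> F x = \<one>\<^bsub>H\<^esub> \<longleftrightarrow> x \<in> coboundaries C D i"
  shows "\<exists>\<theta> \<in> iso (cohomology C D i) H. \<forall>x \<in> cocycles C D i. \<theta> (cohomology_class C D i x) = F x"
proof
  let ?Z = "C\<lparr>carrier := cocycles C D i\<rparr>"
  interpret F: group_hom ?Z H F
    using H hom comm_group.axioms(2)[OF comm_group_cocycles] by (simp add: group_hom_def group_hom_axioms_def)
  have K: "kernel ?Z H F = coboundaries C D i"
    using ker coboundaries_subset by (auto simp: kernel_def)
  let ?\<theta> = "\<lambda>X. the_elem (F ` X)"
  show "?\<theta> \<in> iso (cohomology C D i) H"
    using F.FactGroup_iso_set onto unfolding cohomology_def K by simp
  show "\<forall>x \<in> cocycles C D i. ?\<theta> (cohomology_class C D i x) = F x"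
  proof
    fix x assume x: "x \<in> cocycles C D i"
    have "F y = F x" if y: "y \<in> cohomology_class C D i x" for y
    proof -
      obtain b where b: "b \<in> coboundaries C D i" and yb: "y = b \<otimes> x"
        using y by (auto simp: cohomology_class_def r_coset_def)
      have "F b = \<one>\<^bsub>H\<^esub>" using b ker coboundaries_subset by blast
      then show ?thesis
        using F.hom_mult[of b x] x b coboundaries_subset F.hom_closed[of x] by (auto simp: yb F.H.l_one)
    qed
    moreover have "x \<in> cohomology_class C D i x"
      using x subgroup_coboundaries[of i] unfolding cohomology_class_def
      by (simp add: mem_cocycles_iff rcos_self)
    ultimately have "F ` cohomology_class C D i x = {F x}" by blast
    then show "?\<theta> (cohomology_class C D i x) = F x" by simp
  qed
qed

end

section \<open>Galois modules\<close>

text \<open>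
  The operator \<open>\<epsilon> = (-1)\<^sup>k\<close>.  Treating it as an involution that commutes with all homomorphisms
  makes the computations below uniform in the parity of \<open>k\<close>.
\<close>

definition sign_power :: "('a, 'b) monoid_scheme \<Rightarrow> int \<Rightarrow> 'a \<Rightarrow> 'a" where
  "sign_power G k a = a [^]\<^bsub>G\<^esub> neg_one_power k"

context comm_group
begin

lemma sign_power_eq: "a \<in> carrier G \<Longrightarrow> sign_power G k a = (if even k then a else inv a)"
  by (simp add: sign_power_def neg_one_power_def int_pow_neg int_pow_1)

lemma sign_power_closed [simp]: "a \<in> carrier G \<Longrightarrow> sign_power G k a \<in> carrier G"
  by (simp add: sign_power_eq)

lemma sign_power_mult [simp]:
  "\<lbrakk>a \<in> carrier G; b \<in> carrier G\<rbrakk> \<Longrightarrow> sign_power G k (a \<otimes> b) = sign_power G k a \<otimes> sign_power G k b"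
  by (simp add: sign_power_eq inv_mult)

lemma sign_power_inv [simp]: "a \<in> carrier G \<Longrightarrow> sign_power G k (inv a) = inv (sign_power G k a)"
  by (simp add: sign_power_eq)

lemma sign_power_one [simp]: "sign_power G k \<one> = \<one>"
  by (simp add: sign_power_eq)

lemma sign_power_sign_power [simp]: "a \<in> carrier G \<Longrightarrow> sign_power G k (sign_power G k a) = a"
  by (simp add: sign_power_eq)

lemma sign_power_Suc: "a \<in> carrier G \<Longrightarrow> sign_power G (k + 1) a = inv (sign_power G k a)"
  by (simp add: sign_power_eq)

end

lemma sign_power_hom:
  assumes "comm_group G" "comm_group H" "f \<in> hom G H" "a \<in> carrier G"
  shows "f (sign_power G k a) = sign_power H k (f a)"
proof -
  interpret G: comm_group G by fact
  interpret H: comm_group H by fact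
  interpret f: group_hom G H f by unfold_locales fact
  show ?thesis using assms(4) by (simp add: G.sign_power_eq H.sign_power_eq)
qed

locale galois_module = comm_group A for A :: "('a, 'b) gamma_module_scheme" (structure) +
  assumes gal_closed [simp]: "a \<in> carrier A \<Longrightarrow> gal A a \<in> carrier A"
    and gal_mult [simp]:
      "\<lbrakk>a \<in> carrier A; b \<in> carrier A\<rbrakk> \<Longrightarrow> gal A (a \<otimes> b) = gal A a \<otimes> gal A b"
    and gal_gal [simp]: "a \<in> carrier A \<Longrightarrow> gal A (gal A a) = a"
begin

lemma gal_group_hom: "group_hom A A (gal A)"
  by unfold_locales (simp add: hom_def)

lemmas gal_inv [simp] = group_hom.hom_inv[OF gal_group_hom]
lemmas gal_one [simp] = group_hom.hom_one[OF gal_group_hom]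

lemma gal_sign_power [simp]: "a \<in> carrier A \<Longrightarrow> gal A (sign_power A k a) = sign_power A k (gal A a)"
  by (simp add: sign_power_eq)

lemma tate_d_eq: "a \<in> carrier A \<Longrightarrow> tate_d A k a = gal A a \<otimes> inv (sign_power A k a)"
  using sign_power_Suc[of a k] by (simp add: tate_d_def sign_power_def)

lemma tate_d_Suc_eq: "a \<in> carrier A \<Longrightarrow> tate_d A (k + 1) a = gal A a \<otimes> sign_power A k a"
  by (simp add: tate_d_eq sign_power_Suc)

lemma tate_d_pred_eq: "a \<in> carrier A \<Longrightarrow> tate_d A (k - 1) a = gal A a \<otimes> sign_power A k a"
  using sign_power_Suc[of a "k - 1"] by (simp add: tate_d_eq)

text \<open>
  Both composites of \<open>\<gamma> - \<epsilon>\<close> and \<open>\<gamma> + \<epsilon>\<close> are \<open>\<gamma>\<^sup>2 - 1 = 0\<close>.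
\<close>

lemma tate_complex: "cochain_complex A (tate_d A)"
proof (intro cochain_complex.intro cochain_complex_axioms.intro)
  show "comm_group A" by unfold_locales
  show "tate_d A i \<in> hom A A" for i
    by (auto simp: hom_def tate_d_eq inv_mult m_ac)
  show "tate_d A i (tate_d A (i - 1) a) = \<one>" if "a \<in> carrier A" for i a
    using that by (simp add: tate_d_eq[of _ i] tate_d_pred_eq group_fractions m_ac)
qed

end

locale galois_morphism = A: galois_module A + B: galois_module B
  for A :: "('a, 'c) gamma_module_scheme" and B :: "('b, 'd) gamma_module_scheme" +
  fixes f :: "'a \<Rightarrow> 'b"
  assumes f_hom: "f \<in> hom A B"
    and f_gal: "a \<in> carrier A \<Longrightarrow> f (gal A a) = gal B (f a)"
begin

sublocale group_hom A B f
  by unfold_locales (rule f_hom)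

lemma f_sign_power [simp]: "a \<in> carrier A \<Longrightarrow> f (sign_power A k a) = sign_power B k (f a)"
  using f_hom by (intro sign_power_hom A.comm_group_axioms B.comm_group_axioms)

declare f_gal [simp]

lemma comm_group_DirProd: "comm_group (A \<times>\<times> B)"
  by (intro group.group_comm_groupI DirProd_group A.is_group B.is_group)
     (auto simp: A.m_comm B.m_comm)

lemma hyper_complex: "cochain_complex (A \<times>\<times> B) (hyper_D A B f)"
proof (intro cochain_complex.intro cochain_complex_axioms.intro)
  show "comm_group (A \<times>\<times> B)" by (rule comm_group_DirProd)
  show "hyper_D A B f i \<in> hom (A \<times>\<times> B) (A \<times>\<times> B)" for i
    by (auto simp: hom_def hyper_D_def A.tate_d_eq B.tate_d_eq A.inv_mult A.m_ac B.inv_mult B.m_ac)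
  show "hyper_D A B f i (hyper_D A B f (i - 1) a) = \<one>\<^bsub>A \<times>\<times> B\<^esub>"
    if "a \<in> carrier (A \<times>\<times> B)" for i a
    using that
    by (auto simp: hyper_D_def A.tate_d_Suc_eq A.tate_d_eq[of _ i] B.tate_d_eq[of _ i] B.tate_d_pred_eq)
      (auto simp: A.group_fractions A.m_ac B.group_fractions B.m_ac)
qed

end

section \<open>Exponential sequences\<close>

text \<open>
  What the exponential sequence of a torus provides: \<open>ex\<close> is the exponential map \<open>V \<rightarrow> T\<close>, its
  periods are \<open>2\<iota>X\<close>, and \<open>\<iota>\<close> anticommutes with \<open>\<gamma>\<close>.  Dividing the periods by two makes the points
  \<open>ex(\<iota> a)\<close> of order two visible; for tori they are \<open>a(-1)\<close>.
\<close>

locale exponential_sequence =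
  T: galois_module T + X: galois_module X + V: galois_module V
  for T :: "('t, 'a) gamma_module_scheme" and X :: "('x, 'b) gamma_module_scheme"
    and V :: "('v, 'c) gamma_module_scheme" +
  fixes \<iota> :: "'x \<Rightarrow> 'v" and ex :: "'v \<Rightarrow> 't"
  assumes iota_hom: "\<iota> \<in> hom X V"
    and iota_inj: "\<lbrakk>a \<in> carrier X; b \<in> carrier X; \<iota> a = \<iota> b\<rbrakk> \<Longrightarrow> a = b"
    and iota_gal: "a \<in> carrier X \<Longrightarrow> gal V (\<iota> a) = inv\<^bsub>V\<^esub> \<iota> (gal X a)"
    and ex_hom: "ex \<in> hom V T"
    and ex_gal: "v \<in> carrier V \<Longrightarrow> ex (gal V v) = gal T (ex v)"
    and ex_onto: "t \<in> carrier T \<Longrightarrow> \<exists>v\<in>carrier V. ex v = t"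
    and ex_period: "a \<in> carrier X \<Longrightarrow> ex (\<iota> a) \<otimes>\<^bsub>T\<^esub> ex (\<iota> a) = \<one>\<^bsub>T\<^esub>"
    and ex_ker: "\<lbrakk>v \<in> carrier V; ex v = \<one>\<^bsub>T\<^esub>\<rbrakk> \<Longrightarrow> \<exists>a\<in>carrier X. v = \<iota> a \<otimes>\<^bsub>V\<^esub> \<iota> a"
    and torsion_free: "\<lbrakk>v \<in> carrier V; v \<otimes>\<^bsub>V\<^esub> v = \<one>\<^bsub>V\<^esub>\<rbrakk> \<Longrightarrow> v = \<one>\<^bsub>V\<^esub>"
    and halving: "v \<in> carrier V \<Longrightarrow> \<exists>w\<in>carrier V. w \<otimes>\<^bsub>V\<^esub> w = v"
begin

sublocale iota: group_hom X V \<iota>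
  by unfold_locales (rule iota_hom)

sublocale ex: galois_morphism V T ex
  by unfold_locales (simp_all add: ex_hom ex_gal)

lemma iota_sign_power [simp]: "a \<in> carrier X \<Longrightarrow> \<iota> (sign_power X k a) = sign_power V k (\<iota> a)"
  using iota_hom by (intro sign_power_hom X.comm_group_axioms V.comm_group_axioms)

lemma square_inject:
  assumes "v \<in> carrier V" "w \<in> carrier V" "v \<otimes>\<^bsub>V\<^esub> v = w \<otimes>\<^bsub>V\<^esub> w"
  shows "v = w"
proof -
  have "v \<otimes>\<^bsub>V\<^esub> inv\<^bsub>V\<^esub> w = \<one>\<^bsub>V\<^esub>"
    by (rule torsion_free) (use assms in \<open>simp_all add: V.group_fractions V.m_ac\<close>)
  then show ?thesis using assms by (simp add: V.group_fractions)
qed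

text \<open>
  For a torus this is the value \<open>a(-1)\<close>.  Its being of order two is what makes signs immaterial in
  the formula for \<open>\<theta>\<close>, and what cancels the sign in \<open>\<gamma>\<iota> = -\<iota>\<gamma>\<close> (\<open>gal_sign_point\<close>).
\<close>

definition sign_point :: "'x \<Rightarrow> 't" where
  "sign_point a = ex (\<iota> a)"

lemma sign_point_closed [simp]: "a \<in> carrier X \<Longrightarrow> sign_point a \<in> carrier T"
  by (simp add: sign_point_def)

lemma sign_point_mult [simp]:
  "\<lbrakk>a \<in> carrier X; b \<in> carrier X\<rbrakk> \<Longrightarrow> sign_point (a \<otimes>\<^bsub>X\<^esub> b) = sign_point a \<otimes>\<^bsub>T\<^esub> sign_point b"
  by (simp add: sign_point_def)

lemma inv_sign_point [simp]: "a \<in> carrier X \<Longrightarrow> inv\<^bsub>T\<^esub> sign_point a = sign_point a"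
  using ex_period[of a] by (intro T.inv_equality) (simp_all add: sign_point_def)

lemma sign_point_inv [simp]: "a \<in> carrier X \<Longrightarrow> sign_point (inv\<^bsub>X\<^esub> a) = sign_point a"
  using inv_sign_point[of a] by (simp add: sign_point_def)

lemma sign_power_sign_point [simp]: "a \<in> carrier X \<Longrightarrow> sign_power T k (sign_point a) = sign_point a"
  by (simp add: T.sign_power_eq)

lemma sign_point_sign_power [simp]: "a \<in> carrier X \<Longrightarrow> sign_point (sign_power X k a) = sign_point a"
  by (simp add: X.sign_power_eq)

lemma gal_sign_point [simp]: "a \<in> carrier X \<Longrightarrow> gal T (sign_point a) = sign_point (gal X a)"
  using iota_gal[of a] inv_sign_point[of "gal X a"] by (simp add: sign_point_def flip: ex.f_gal)

end

locale exponential_morphism =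
  S: exponential_sequence T X V \<iota> ex + S': exponential_sequence T' X' V' \<iota>' ex' +
  j: galois_morphism T T' j + f: galois_morphism X X' f + L: galois_morphism V V' L
  for T :: "('t, 'a) gamma_module_scheme" and X :: "('x, 'b) gamma_module_scheme"
    and V :: "('v, 'c) gamma_module_scheme" and \<iota> ex
    and T' :: "('t1, 'a1) gamma_module_scheme" and X' :: "('x1, 'b1) gamma_module_scheme"
    and V' :: "('v1, 'c1) gamma_module_scheme" and \<iota>' ex'
    and j :: "'t \<Rightarrow> 't1" and f :: "'x \<Rightarrow> 'x1" and L :: "'v \<Rightarrow> 'v1" +
  assumes L_iota: "a \<in> carrier X \<Longrightarrow> L (\<iota> a) = \<iota>' (f a)"
    and j_ex: "v \<in> carrier V \<Longrightarrow> j (ex v) = ex' (L v)"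
    and j_onto: "j ` carrier T = carrier T'"
begin

lemma j_sign_point [simp]: "a \<in> carrier X \<Longrightarrow> j (S.sign_point a) = S'.sign_point (f a)"
  by (simp add: S.sign_point_def S'.sign_point_def j_ex L_iota)

abbreviation A :: "('t, 'a) gamma_module_scheme" where
  "A \<equiv> T\<lparr>carrier := kernel T T' j\<rparr>"

lemma subgroup_kernel_j: "subgroup (kernel T T' j) T"
  by (rule j.subgroup_kernel)

lemma galois_module_A: "galois_module A"
proof (intro galois_module.intro galois_module_axioms.intro)
  show "comm_group A"
  proof (rule group.group_comm_groupI)
    show "group A"
      by (rule subgroup.subgroup_is_group[OF subgroup_kernel_j S.T.is_group])
  qed (simp add: kernel_def S.T.m_comm)
qed (auto simp: kernel_def)

sublocale A: galois_module A
  by (rule galois_module_A)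

sublocale HA: cochain_complex A "tate_d A"
  by (rule A.tate_complex)

sublocale HX: cochain_complex "X \<times>\<times> X'" "hyper_D X X' f"
  by (rule f.hyper_complex)

lemma sign_power_A: "a \<in> kernel T T' j \<Longrightarrow> sign_power A k a = sign_power T k a"
  using S.T.m_inv_consistent[OF subgroup_kernel_j, of a]
    A.sign_power_eq[of a k] S.T.sign_power_eq[of a k] subgroup.mem_carrier[OF subgroup_kernel_j, of a]
  by simp

lemma tate_d_A_Suc: "a \<in> kernel T T' j \<Longrightarrow> tate_d A (k + 1) a = gal T a \<otimes>\<^bsub>T\<^esub> sign_power T k a"
  using A.tate_d_Suc_eq[of a k] by (simp add: sign_power_A)

lemma tate_d_A: "a \<in> kernel T T' j \<Longrightarrow> tate_d A k a = gal T a \<otimes>\<^bsub>T\<^esub> inv\<^bsub>T\<^esub> sign_power T k a"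
  using A.tate_d_eq[of a k] S.T.m_inv_consistent[OF subgroup_kernel_j, of "sign_power T k a"]
   A.sign_power_closed[of a k]
  by (simp add: sign_power_A)

lemma hypercocycle_iff:
  "(a, b) \<in> hypercocycles X X' f k \<longleftrightarrow> a \<in> carrier X \<and> b \<in> carrier X' \<and>
     gal X a = inv\<^bsub>X\<^esub> sign_power X k a \<and> f a = gal X' b \<otimes>\<^bsub>X'\<^esub> inv\<^bsub>X'\<^esub> sign_power X' k b"
  by (auto simp: HX.mem_cocycles_iff hyper_D_def S.X.tate_d_Suc_eq S'.X.tate_d_eq
      S.X.group_fractions S'.X.group_fractions S'.X.m_ac)

definition theta :: "int \<Rightarrow> 'x \<Rightarrow> 't \<Rightarrow> 't" where
  "theta k a t = S.sign_point a \<otimes>\<^bsub>T\<^esub> inv\<^bsub>T\<^esub> gal T t \<otimes>\<^bsub>T\<^esub> sign_power T k t"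

lemma theta_closed [simp]:
  "\<lbrakk>a \<in> carrier X; t \<in> carrier T\<rbrakk> \<Longrightarrow> theta k a t \<in> carrier T"
  by (simp add: theta_def)

lemma theta_mult:
  "\<lbrakk>a \<in> carrier X; b \<in> carrier X; t \<in> carrier T; s \<in> carrier T\<rbrakk>
    \<Longrightarrow> theta k (a \<otimes>\<^bsub>X\<^esub> b) (t \<otimes>\<^bsub>T\<^esub> s) = theta k a t \<otimes>\<^bsub>T\<^esub> theta k b s"
  by (simp add: theta_def S.T.inv_mult S.T.m_ac)

section \<open>The map on cocycles\<close>

text \<open>
  Applying \<open>j\<close> to \<open>a(-1) - \<gamma>t + \<epsilon>t\<close> gives \<open>(f a - \<gamma>b + \<epsilon>b)(-1) = 0\<close>, and \<open>\<gamma> + \<epsilon>\<close> kills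
  both \<open>(\<gamma> - \<epsilon>)t\<close> and \<open>a\<close>.
\<close>

lemma theta_cocycle:
  assumes ab: "(a, b) \<in> hypercocycles X X' f k" and t: "t \<in> carrier T" "j t = S'.sign_point b"
  shows "theta k a t \<in> tate_cocycles A (k + 1)"
proof -
  note [simp] = t
  have a [simp]: "a \<in> carrier X" and b [simp]: "b \<in> carrier X'"
    and ga: "gal X a = inv\<^bsub>X\<^esub> sign_power X k a"
    and fa: "f a = gal X' b \<otimes>\<^bsub>X'\<^esub> inv\<^bsub>X'\<^esub> sign_power X' k b"
    using ab by (simp_all add: hypercocycle_iff)
  have "j (theta k a t) = S'.sign_point (gal X' b) \<otimes>\<^bsub>T'\<^esub> S'.sign_point b
      \<otimes>\<^bsub>T'\<^esub> inv\<^bsub>T'\<^esub> S'.sign_point (gal X' b) \<otimes>\<^bsub>T'\<^esub> inv\<^bsub>T'\<^esub> S'.sign_point b"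
    by (simp add: theta_def fa)
  also have "\<dots> = \<one>\<^bsub>T'\<^esub>"
    by (simp add: S'.T.group_fractions S'.T.m_ac del: S'.inv_sign_point)
  finally have K: "theta k a t \<in> kernel T T' j"
    by (simp add: kernel_def)
  have "gal T (theta k a t) \<otimes>\<^bsub>T\<^esub> sign_power T k (theta k a t) = S.sign_point a \<otimes>\<^bsub>T\<^esub> S.sign_point a"
    by (simp add: theta_def ga) (simp add: S.T.group_fractions S.T.m_ac del: S.inv_sign_point)
  also have "\<dots> = \<one>\<^bsub>T\<^esub>"
    by (simp add: S.sign_point_def S.ex_period)
  finally show ?thesis
    using K by (simp add: HA.mem_cocycles_iff tate_d_A_Suc)
qed

text \<open>
  Two lifts differ by an element of \<open>A\<close>, and \<open>\<theta>\<close> changes by its coboundary.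
\<close>

lemma theta_change_lift:
  assumes "a \<in> carrier X" "t \<in> carrier T" "s \<in> carrier T" "j t = j s"
  shows "theta k a t \<otimes>\<^bsub>T\<^esub> inv\<^bsub>T\<^esub> theta k a s \<in> coboundaries A (tate_d A) (k + 1)"
proof -
  note [simp] = assms
  let ?b = "s \<otimes>\<^bsub>T\<^esub> inv\<^bsub>T\<^esub> t"
  have b: "?b \<in> kernel T T' j"
    by (simp add: kernel_def S'.T.r_inv)
  have "theta k a t \<otimes>\<^bsub>T\<^esub> inv\<^bsub>T\<^esub> theta k a s = tate_d A k ?b"
    unfolding tate_d_A[OF b] by (simp add: theta_def) (simp add: S.T.group_fractions S.T.m_ac)
  then show ?thesis
    using b by (auto simp: coboundaries_def)
qed

text \<open>
  If \<open>(a, b)\<close> bounds \<open>(c, d)\<close> and \<open>s\<close> lifts \<open>d(-1)\<close>, then \<open>t = \<gamma>s + \<epsilon>s - c(-1)\<close> lifts \<open>b(-1)\<close>; in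
  \<open>a(-1) - \<gamma>t + \<epsilon>t\<close> the terms with \<open>s\<close> cancel since \<open>(\<gamma> - \<epsilon>)(\<gamma> + \<epsilon>) = 0\<close>, and those with \<open>c\<close>
  cancel because \<open>a = -\<gamma>c + \<epsilon>c\<close>.
\<close>

lemma theta_coboundary:
  assumes ab: "(a, b) \<in> coboundaries (X \<times>\<times> X') (hyper_D X X' f) k"
  obtains t where "t \<in> carrier T" "j t = S'.sign_point b" "theta k a t = \<one>\<^bsub>T\<^esub>"
proof -
  obtain c d where c [simp]: "c \<in> carrier X" and d [simp]: "d \<in> carrier X'"
    and a: "a = inv\<^bsub>X\<^esub> (gal X c \<otimes>\<^bsub>X\<^esub> inv\<^bsub>X\<^esub> sign_power X k c)"
    and b: "b = gal X' d \<otimes>\<^bsub>X'\<^esub> sign_power X' k d \<otimes>\<^bsub>X'\<^esub> inv\<^bsub>X'\<^esub> f c"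
    using ab by (auto simp: coboundaries_def hyper_D_def S.X.tate_d_eq S'.X.tate_d_pred_eq)
  have "S'.sign_point d \<in> j ` carrier T"
    unfolding j_onto by simp
  then obtain s where s [simp]: "s \<in> carrier T" and js [simp]: "j s = S'.sign_point d"
    by auto
  let ?t = "gal T s \<otimes>\<^bsub>T\<^esub> sign_power T k s \<otimes>\<^bsub>T\<^esub> inv\<^bsub>T\<^esub> S.sign_point c"
  show ?thesis
  proof
    show "?t \<in> carrier T" by simp
    show "j ?t = S'.sign_point b"
      by (simp add: b del: S'.inv_sign_point)
    have "S.sign_point a = inv\<^bsub>T\<^esub> S.sign_point (gal X c) \<otimes>\<^bsub>T\<^esub> S.sign_point c"
      by (simp add: a)
    then show "theta k a ?t = \<one>\<^bsub>T\<^esub>"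
      by (simp add: theta_def del: S.inv_sign_point)
        (simp add: S.T.group_fractions S.T.m_ac del: S.inv_sign_point)
  qed
qed

text \<open>
  Write \<open>t = ex v\<close>.  The hypothesis says that \<open>w = \<iota>a - \<gamma>v + \<epsilon>v\<close> is a period \<open>2\<iota>r\<close>.  The operator
  \<open>\<gamma> + \<epsilon>\<close> removes \<open>v\<close> from \<open>w\<close>, and dividing by two expresses \<open>a\<close> through \<open>r\<close>: this is the place
  where the unique 2-divisibility of \<open>V\<close> replaces the vanishing of its cohomology.  Similarly
  \<open>L v = \<iota>'b + 2\<iota>'r'\<close>, and applying \<open>L\<close> to \<open>w = 2\<iota>r\<close> yields \<open>f r\<close>.  The two formulas say that
  \<open>(a, b)\<close> is the coboundary of \<open>(\<epsilon>r, \<epsilon>(b + r'))\<close>.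
\<close>

lemma theta_injective:
  assumes ab: "(a, b) \<in> hypercocycles X X' f k"
    and t: "t \<in> carrier T" "j t = S'.sign_point b" and one: "theta k a t = \<one>\<^bsub>T\<^esub>"
  shows "(a, b) \<in> coboundaries (X \<times>\<times> X') (hyper_D X X' f) k"
proof -
  have a [simp]: "a \<in> carrier X" and b [simp]: "b \<in> carrier X'"
    and ga: "gal X a = inv\<^bsub>X\<^esub> sign_power X k a"
    and fa: "f a = gal X' b \<otimes>\<^bsub>X'\<^esub> inv\<^bsub>X'\<^esub> sign_power X' k b"
    using ab by (simp_all add: hypercocycle_iff)
  obtain v where v [simp]: "v \<in> carrier V" and ev: "ex v = t"
    using S.ex_onto t by blast
  let ?w = "\<iota> a \<otimes>\<^bsub>V\<^esub> inv\<^bsub>V\<^esub> gal V v \<otimes>\<^bsub>V\<^esub> sign_power V k v"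
  have "ex ?w = \<one>\<^bsub>T\<^esub>"
    using one by (simp add: theta_def S.sign_point_def ev)
  then obtain r where r [simp]: "r \<in> carrier X" and w: "?w = \<iota> r \<otimes>\<^bsub>V\<^esub> \<iota> r"
    using S.ex_ker[of ?w] by auto
  \<comment> \<open>The contributions of \<open>v\<close> cancel, and \<open>\<gamma>\<iota>a = \<epsilon>\<iota>a\<close> since \<open>\<gamma>a = -\<epsilon>a\<close>.\<close>
  have "sign_power V k (\<iota> a) \<otimes>\<^bsub>V\<^esub> sign_power V k (\<iota> a) = gal V ?w \<otimes>\<^bsub>V\<^esub> sign_power V k ?w"
    by (simp add: S.iota_gal ga) (simp add: S.V.group_fractions S.V.m_ac)
  also have "\<dots> = (gal V (\<iota> r) \<otimes>\<^bsub>V\<^esub> sign_power V k (\<iota> r)) \<otimes>\<^bsub>V\<^esub> (gal V (\<iota> r) \<otimes>\<^bsub>V\<^esub> sign_power V k (\<iota> r))"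
    unfolding w by (simp add: S.V.m_ac)
  finally have "sign_power V k (\<iota> a) = gal V (\<iota> r) \<otimes>\<^bsub>V\<^esub> sign_power V k (\<iota> r)"
    by (rule S.square_inject[rotated 2]) simp_all
  then have "\<iota> (sign_power X k a) = \<iota> (inv\<^bsub>X\<^esub> gal X r \<otimes>\<^bsub>X\<^esub> sign_power X k r)"
    by (simp add: S.iota_gal)
  then have "sign_power X k a = inv\<^bsub>X\<^esub> gal X r \<otimes>\<^bsub>X\<^esub> sign_power X k r"
    by (intro S.iota_inj) simp_all
  then have "sign_power X k (sign_power X k a) = sign_power X k (inv\<^bsub>X\<^esub> gal X r \<otimes>\<^bsub>X\<^esub> sign_power X k r)"
    by simp
  then have a_eq: "a = inv\<^bsub>X\<^esub> sign_power X k (gal X r) \<otimes>\<^bsub>X\<^esub> r"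
    by simp
  have "ex' (L v \<otimes>\<^bsub>V'\<^esub> inv\<^bsub>V'\<^esub> \<iota>' b) = \<one>\<^bsub>T'\<^esub>"
    using t(2) by (simp add: S'.sign_point_def flip: ev j_ex)
  then obtain r' where r' [simp]: "r' \<in> carrier X'"
    and "L v \<otimes>\<^bsub>V'\<^esub> inv\<^bsub>V'\<^esub> \<iota>' b = \<iota>' r' \<otimes>\<^bsub>V'\<^esub> \<iota>' r'"
    using S'.ex_ker[of "L v \<otimes>\<^bsub>V'\<^esub> inv\<^bsub>V'\<^esub> \<iota>' b"] by auto
  then have Lv: "L v = \<iota>' r' \<otimes>\<^bsub>V'\<^esub> \<iota>' r' \<otimes>\<^bsub>V'\<^esub> \<iota>' b"
    by (simp add: S'.V.group_fractions)
  let ?c = "gal X' b \<otimes>\<^bsub>X'\<^esub> gal X' r' \<otimes>\<^bsub>X'\<^esub> sign_power X' k r'"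
  have "\<iota>' (f r) \<otimes>\<^bsub>V'\<^esub> \<iota>' (f r) = L ?w"
    unfolding w by (simp add: L_iota)
  also have "\<dots> = \<iota>' ?c \<otimes>\<^bsub>V'\<^esub> \<iota>' ?c"
    by (simp add: L_iota fa Lv S'.iota_gal) (simp add: S'.V.group_fractions S'.V.m_ac)
  finally have "\<iota>' (f r) = \<iota>' ?c"
    by (rule S'.square_inject[rotated 2]) simp_all
  then have fr: "f r = ?c"
    by (intro S'.iota_inj) simp_all
  have "hyper_D X X' f (k - 1) (sign_power X k r, sign_power X' k (b \<otimes>\<^bsub>X'\<^esub> r')) = (a, b)"
    by (simp add: hyper_D_def S.X.tate_d_eq S'.X.tate_d_pred_eq a_eq fr)
      (simp add: S.X.group_fractions S.X.m_ac S'.X.group_fractions S'.X.m_ac)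
  then show ?thesis
    unfolding coboundaries_def
    by (intro image_eqI[of _ _ "(sign_power X k r, sign_power X' k (b \<otimes>\<^bsub>X'\<^esub> r'))"]) simp_all
qed

text \<open>
  Let \<open>w\<close> be half a logarithm of the cocycle \<open>x\<close>.  Since \<open>\<gamma>x + \<epsilon>x = 0\<close>, the element
  \<open>\<gamma>w + \<epsilon>w\<close> is half a period, say \<open>\<iota>r\<close>; since \<open>j x = 0\<close>, also \<open>L w = \<iota>'r'\<close>.  With
  \<open>t = ex(\<epsilon>w)\<close> and \<open>a = \<epsilon>r\<close> one gets \<open>a(-1) - \<gamma>t + \<epsilon>t = ex(\<epsilon>\<gamma>w + w - \<epsilon>\<gamma>w + w) = x\<close>.
\<close>

lemma theta_surjective:
  assumes x: "x \<in> tate_cocycles A (k + 1)"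
  obtains a b t where "(a, b) \<in> hypercocycles X X' f k" "t \<in> carrier T" "j t = S'.sign_point b"
    "theta k a t = x"
proof -
  have K: "x \<in> kernel T T' j" using x by (simp add: HA.mem_cocycles_iff)
  have x_closed [simp]: "x \<in> carrier T" and jx: "j x = \<one>\<^bsub>T'\<^esub>"
    using K by (simp_all add: kernel_def)
  have gx: "gal T x \<otimes>\<^bsub>T\<^esub> sign_power T k x = \<one>\<^bsub>T\<^esub>"
    using x K by (simp add: HA.mem_cocycles_iff tate_d_A_Suc)
  obtain v where v [simp]: "v \<in> carrier V" and ev: "ex v = x"
    using S.ex_onto[of x] by auto
  obtain w where w [simp]: "w \<in> carrier V" and ww: "w \<otimes>\<^bsub>V\<^esub> w = v"
    using S.halving[of v] by auto
  have "ex (gal V v \<otimes>\<^bsub>V\<^esub> sign_power V k v) = \<one>\<^bsub>T\<^esub>"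
    using gx by (simp add: ev)
  then obtain r where r [simp]: "r \<in> carrier X"
    and "gal V v \<otimes>\<^bsub>V\<^esub> sign_power V k v = \<iota> r \<otimes>\<^bsub>V\<^esub> \<iota> r"
    using S.ex_ker[of "gal V v \<otimes>\<^bsub>V\<^esub> sign_power V k v"] by auto
  then have "(gal V w \<otimes>\<^bsub>V\<^esub> sign_power V k w) \<otimes>\<^bsub>V\<^esub> (gal V w \<otimes>\<^bsub>V\<^esub> sign_power V k w) = \<iota> r \<otimes>\<^bsub>V\<^esub> \<iota> r"
    unfolding ww[symmetric] by (simp add: S.V.m_ac)
  then have ir: "\<iota> r = gal V w \<otimes>\<^bsub>V\<^esub> sign_power V k w"
    by (rule S.square_inject[rotated 2, symmetric]) simp_all
  have "ex' (L v) = \<one>\<^bsub>T'\<^esub>"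
    using jx by (simp flip: ev j_ex)
  then obtain r' where r' [simp]: "r' \<in> carrier X'" and "L v = \<iota>' r' \<otimes>\<^bsub>V'\<^esub> \<iota>' r'"
    using S'.ex_ker[of "L v"] by auto
  then have "L w \<otimes>\<^bsub>V'\<^esub> L w = \<iota>' r' \<otimes>\<^bsub>V'\<^esub> \<iota>' r'"
    by (simp flip: ww)
  then have Lw: "L w = \<iota>' r'"
    by (rule S'.square_inject[rotated 2]) simp_all
  have "inv\<^bsub>V\<^esub> \<iota> (gal X r) = sign_power V k (\<iota> r)"
    by (simp add: S.V.m_comm ir flip: S.iota_gal)
  then have "inv\<^bsub>V\<^esub> (inv\<^bsub>V\<^esub> \<iota> (gal X r)) = inv\<^bsub>V\<^esub> sign_power V k (\<iota> r)"
    by simp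
  then have "\<iota> (gal X r) = \<iota> (inv\<^bsub>X\<^esub> sign_power X k r)"
    by simp
  then have gr: "gal X r = inv\<^bsub>X\<^esub> sign_power X k r"
    by (intro S.iota_inj) simp_all
  have "\<iota>' (f r) = \<iota>' (inv\<^bsub>X'\<^esub> gal X' r' \<otimes>\<^bsub>X'\<^esub> sign_power X' k r')"
    by (simp add: ir Lw S'.iota_gal flip: L_iota)
  then have fr: "f r = inv\<^bsub>X'\<^esub> gal X' r' \<otimes>\<^bsub>X'\<^esub> sign_power X' k r'"
    by (intro S'.iota_inj) simp_all
  show ?thesis
  proof
    \<comment> \<open>The second component is \<open>-\<epsilon>r'\<close>: the sign is forced by the cocycle condition and invisible at \<open>-1\<close>.\<close>
    show "(sign_power X k r, inv\<^bsub>X'\<^esub> sign_power X' k r') \<in> hypercocycles X X' f k"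
      by (simp add: hypercocycle_iff gr fr)
    show "ex (sign_power V k w) \<in> carrier T" by simp
    show "j (ex (sign_power V k w)) = S'.sign_point (inv\<^bsub>X'\<^esub> sign_power X' k r')"
      by (simp add: j_ex Lw) (simp add: S'.sign_point_def[symmetric])
    have "S.sign_point (sign_power X k r) = sign_power T k (ex (\<iota> r))"
      by (simp add: S.sign_point_def)
    then show "theta k (sign_power X k r) (ex (sign_power V k w)) = x"
      by (simp add: theta_def ir flip: ww ev) (simp add: S.T.group_fractions S.T.m_ac)
  qed
qed

text \<open>
  The class of \<open>\<theta>\<close> does not depend on the lift of \<open>b(-1)\<close>, so that an arbitrary choice defines it.
\<close>

definition chosen_lift :: "'x1 \<Rightarrow> 't" where
  "chosen_lift b = (SOME t. t \<in> carrier T \<and> j t = S'.sign_point b)"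

lemma chosen_lift:
  assumes "b \<in> carrier X'"
  shows "chosen_lift b \<in> carrier T" "j (chosen_lift b) = S'.sign_point b"
proof -
  have "S'.sign_point b \<in> j ` carrier T" unfolding j_onto using assms by simp
  then have "\<exists>t. t \<in> carrier T \<and> j t = S'.sign_point b" by force
  from someI_ex[OF this] show "chosen_lift b \<in> carrier T" "j (chosen_lift b) = S'.sign_point b"
    by (simp_all add: chosen_lift_def)
qed

definition theta_class :: "int \<Rightarrow> 'x \<times> 'x1 \<Rightarrow> 't set" where
  "theta_class k = (\<lambda>(a, b). tate_class A (k + 1) (theta k a (chosen_lift b)))"

lemma theta_class_eq:
  assumes ab: "(a, b) \<in> hypercocycles X X' f k" and t: "t \<in> carrier T" "j t = S'.sign_point b"
  shows "theta_class k (a, b) = tate_class A (k + 1) (theta k a t)"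
proof -
  have a: "a \<in> carrier X" and b: "b \<in> carrier X'"
    using ab by (simp_all add: hypercocycle_iff)
  note c = chosen_lift[OF b]
  have "theta k a t \<in> kernel T T' j"
    using theta_cocycle[OF ab t] by (simp add: HA.mem_cocycles_iff)
  then show ?thesis
    using theta_change_lift[OF a c(1) t(1), of k] c t
    by (simp add: theta_class_def)
      (intro HA.cohomology_class_cong theta_cocycle[OF ab],
        simp_all add: S.T.m_inv_consistent[OF subgroup_kernel_j])
qed

theorem theta_iso:
  "\<exists>\<theta> \<in> iso (hypercohomology X X' f k) (tate_cohomology A (k + 1)).
     \<forall>a b t. (a, b) \<in> hypercocycles X X' f k \<longrightarrow> t \<in> carrier T \<longrightarrow> j t = S'.sign_point b \<longrightarrow>
       theta k a t \<in> tate_cocycles A (k + 1) \<and>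
       \<theta> (hyper_class X X' f k (a, b)) = tate_class A (k + 1) (theta k a t)"
proof -
  let ?Z = "hypercocycles X X' f k"
  have "\<exists>\<theta> \<in> iso (hypercohomology X X' f k) (tate_cohomology A (k + 1)).
    \<forall>x \<in> ?Z. \<theta> (hyper_class X X' f k x) = theta_class k x"
  proof (rule HX.induced_iso[OF HA.group_cohomology])
    have closed: "theta_class k x \<in> carrier (tate_cohomology A (k + 1))" if "x \<in> ?Z" for x
    proof -
      obtain a b where x: "x = (a, b)" by fastforce
      have "b \<in> carrier X'" using that by (simp add: x hypercocycle_iff)
      note theta_cocycle[OF that[unfolded x] chosen_lift[OF this]]
      then show ?thesis by (simp add: x theta_class_def HA.carrier_cohomology)
    qed
    have mult: "theta_class k (x \<otimes>\<^bsub>X \<times>\<times> X'\<^esub> y)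
        = theta_class k x \<otimes>\<^bsub>tate_cohomology A (k + 1)\<^esub> theta_class k y"
      if "x \<in> ?Z" "y \<in> ?Z" for x y
    proof -
      obtain a b a' b' where x: "x = (a, b)" and y: "y = (a', b')" by fastforce
      have ab: "a \<in> carrier X" "b \<in> carrier X'" "a' \<in> carrier X" "b' \<in> carrier X'"
        using that by (simp_all add: x y hypercocycle_iff)
      note c = chosen_lift[OF ab(2)] and c' = chosen_lift[OF ab(4)]
      have xy: "(a \<otimes>\<^bsub>X\<^esub> a', b \<otimes>\<^bsub>X'\<^esub> b') \<in> ?Z"
        using subgroup.m_closed[OF HX.subgroup_cocycles that] by (simp add: x y)
      have "theta_class k (a \<otimes>\<^bsub>X\<^esub> a', b \<otimes>\<^bsub>X'\<^esub> b')
          = tate_class A (k + 1) (theta k (a \<otimes>\<^bsub>X\<^esub> a') (chosen_lift b \<otimes>\<^bsub>T\<^esub> chosen_lift b'))"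
        by (rule theta_class_eq[OF xy]) (simp_all add: c c' ab)
      also have "\<dots> = tate_class A (k + 1)
          (theta k a (chosen_lift b) \<otimes>\<^bsub>A\<^esub> theta k a' (chosen_lift b'))"
        by (simp add: theta_mult ab c c')
      finally show ?thesis
        using HA.cohomology_class_mult[OF theta_cocycle[OF that(1)[unfolded x] c]
            theta_cocycle[OF that(2)[unfolded y] c']]
        by (simp add: x y theta_class_def)
    qed
    show "theta_class k \<in> hom ((X \<times>\<times> X')\<lparr>carrier := ?Z\<rparr>) (tate_cohomology A (k + 1))"
      using closed mult by (simp add: hom_def)
    have "c \<in> theta_class k ` ?Z" if c: "c \<in> carrier (tate_cohomology A (k + 1))" for c
    proof -
      obtain x where x: "x \<in> tate_cocycles A (k + 1)" and cx: "c = tate_class A (k + 1) x"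
        using c by (auto simp: HA.carrier_cohomology)
      obtain a b t where abt: "(a, b) \<in> ?Z" "t \<in> carrier T" "j t = S'.sign_point b" "theta k a t = x"
        using theta_surjective[OF x] by blast
      show ?thesis
        by (rule image_eqI[OF _ abt(1)]) (simp add: theta_class_eq[OF abt(1-3)] abt(4) cx)
    qed
    then show "theta_class k ` ?Z = carrier (tate_cohomology A (k + 1))"
      using closed by blast
    show "theta_class k x = \<one>\<^bsub>tate_cohomology A (k + 1)\<^esub> \<longleftrightarrow>
        x \<in> coboundaries (X \<times>\<times> X') (hyper_D X X' f) k" if x: "x \<in> ?Z" for x
    proof -
      obtain a b where x_eq: "x = (a, b)" by fastforce
      have ab: "(a, b) \<in> ?Z" using x by (simp add: x_eq)
      have a: "a \<in> carrier X" and b: "b \<in> carrier X'" using ab by (simp_all add: hypercocycle_iff)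
      note c = chosen_lift[OF b]
      show ?thesis
      proof
        assume "theta_class k x = \<one>\<^bsub>tate_cohomology A (k + 1)\<^esub>"
        then have "theta k a (chosen_lift b) \<in> coboundaries A (tate_d A) (k + 1)"
          using HA.cohomology_class_eq_one_iff[OF theta_cocycle[OF ab c]]
          by (simp add: theta_class_def x_eq)
        then obtain y where yK: "y \<in> kernel T T' j"
          and y: "theta k a (chosen_lift b) = gal T y \<otimes>\<^bsub>T\<^esub> inv\<^bsub>T\<^esub> sign_power T k y"
          by (auto simp: coboundaries_def tate_d_A)
        have [simp]: "y \<in> carrier T" "j y = \<one>\<^bsub>T'\<^esub>" using yK by (simp_all add: kernel_def)
        \<comment> \<open>Changing the lift by \<open>y\<close> subtracts the coboundary of \<open>y\<close>, and \<open>\<theta>\<close> becomes trivial on the nose.\<close>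
        have "theta k a (chosen_lift b \<otimes>\<^bsub>T\<^esub> y)
            = theta k a (chosen_lift b) \<otimes>\<^bsub>T\<^esub> (inv\<^bsub>T\<^esub> gal T y \<otimes>\<^bsub>T\<^esub> sign_power T k y)"
          by (simp add: theta_def a c S.T.inv_mult S.T.m_ac)
        also have "\<dots> = \<one>\<^bsub>T\<^esub>"
          unfolding y by (simp add: S.T.group_fractions S.T.m_ac)
        finally show "x \<in> coboundaries (X \<times>\<times> X') (hyper_D X X' f) k"
          unfolding x_eq using c b by (intro theta_injective[OF ab]) simp_all
      next
        assume "x \<in> coboundaries (X \<times>\<times> X') (hyper_D X X' f) k"
        then obtain t where t: "t \<in> carrier T" "j t = S'.sign_point b" "theta k a t = \<one>\<^bsub>T\<^esub>"
          unfolding x_eq by (rule theta_coboundary)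
        have "theta_class k x = tate_class A (k + 1) \<one>\<^bsub>A\<^esub>"
          using theta_class_eq[OF ab t(1,2)] t(3) by (simp add: x_eq)
        also have "\<dots> = \<one>\<^bsub>tate_cohomology A (k + 1)\<^esub>"
          using HA.cohomology_class_eq_one_iff[of "\<one>\<^bsub>A\<^esub>" "k + 1"]
            subgroup.one_closed[OF HA.subgroup_cocycles] subgroup.one_closed[OF HA.subgroup_coboundaries]
          by blast
        finally show "theta_class k x = \<one>\<^bsub>tate_cohomology A (k + 1)\<^esub>" .
      qed
    qed
  qed
  then obtain \<theta> where \<theta>: "\<theta> \<in> iso (hypercohomology X X' f k) (tate_cohomology A (k + 1))"
    and eq: "\<And>x. x \<in> ?Z \<Longrightarrow> \<theta> (hyper_class X X' f k x) = theta_class k x"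
    by blast
  show ?thesis
    using \<theta> by (rule bexI[rotated]) (simp add: eq theta_class_eq theta_cocycle)
qed

end

section \<open>Matrix groups over the real numbers\<close>

lemma complex_points_simps [simp]:
  "carrier (complex_points n G) = G"
  "monoid.mult (complex_points n G) = (*)"
  "one (complex_points n G) = 1\<^sub>m n"
  "gal (complex_points n G) = map_mat cnj"
  by (simp_all add: complex_points_def)

lemma Gm_simps [simp]:
  "carrier Gm = - {0}" "monoid.mult Gm = (*)" "one Gm = 1"
  by (simp_all add: Gm_def)

lemma GL_D: "g \<in> GL n \<Longrightarrow> g \<in> carrier_mat n n \<and> det g \<noteq> 0"
  by (simp add: GL_def)

interpretation cnj_hom: field_hom cnj
  by unfold_locales auto

lemma map_mat_cnj_mult:
  "\<lbrakk>g \<in> carrier_mat n n; h \<in> carrier_mat n n\<rbrakk> \<Longrightarrow> map_mat cnj (g * h) = map_mat cnj g * map_mat cnj h"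
  by (rule cnj_hom.mat_hom_mult)

lemma map_mat_cnj_cnj [simp]: "map_mat cnj (map_mat cnj g) = g"
  by (rule eq_matI) simp_all

text \<open>
  Functions with real coefficients commute with complex conjugation.  This gives both the Galois
  action on the points of a real group and the equivariance of homomorphisms over \<open>\<real>\<close>.
\<close>

lemma regular_GL_cnj:
  assumes "p \<in> regular_GL \<real> n" "g \<in> carrier_mat n n"
  shows "p (map_mat cnj g) = cnj (p g)"
  using assms(1) unfolding regular_GL_def
proof (induction rule: generated_algebra.induct)
  case (const c)
  then show ?case by (simp add: Reals_cnj_iff)
next
  case (gen f)
  then show ?case using assms(2) by auto
qed auto

lemma real_group_subset: "real_group n G \<Longrightarrow> G \<subseteq> GL n"
  by (auto simp: real_group_def dest: subgroup.subset)

lemma real_group_cnj: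
  assumes "real_group n G" "g \<in> G"
  shows "map_mat cnj g \<in> G"
proof -
  obtain S where S: "S \<subseteq> regular_GL \<real> n" and G: "G = {g \<in> GL n. \<forall>p\<in>S. p g = 0}"
    using assms(1) by (auto simp: real_group_def)
  show ?thesis
    using assms(2) S by (auto simp: G GL_def regular_GL_cnj)
qed

lemma alg_hom_cnj:
  assumes "j \<in> alg_hom \<real> n G m H" "G \<subseteq> GL n" "H \<subseteq> GL m" "g \<in> G" "map_mat cnj g \<in> G"
  shows "j (map_mat cnj g) = map_mat cnj (j g)"
proof -
  have dims: "j g \<in> carrier_mat m m" "j (map_mat cnj g) \<in> carrier_mat m m"
    using assms by (auto simp: alg_hom_def hom_def dest!: GL_D)
  have g: "g \<in> carrier_mat n n" using assms(2,4) by (auto dest!: GL_D)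
  show ?thesis
  proof (rule eq_matI)
    fix a b assume "a < dim_row (map_mat cnj (j g))" "b < dim_col (map_mat cnj (j g))"
    then have ab: "a < m" "b < m" using dims by auto
    then obtain p where "p \<in> regular_GL \<real> n" "\<forall>g\<in>G. j g $$ (a, b) = p g"
      using assms(1) unfolding alg_hom_def by blast
    then show "j (map_mat cnj g) $$ (a, b) = map_mat cnj (j g) $$ (a, b)"
      using assms(4,5) dims ab g by (simp add: regular_GL_cnj)
  qed (use dims in auto)
qed

section \<open>Homomorphisms from a parameter group to a matrix group\<close>

text \<open>
  Cocharacters and one-parameter subgroups are treated together: both are homomorphisms from a
  commutative group \<open>M\<close> of complex numbers whose matrix entries belong to an algebra of
  functions on \<open>M\<close> (Laurent polynomials on \<open>\<complex>\<^sup>*\<close> and entire functions on \<open>\<complex>\<close>, respectively).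
  The predicate \<open>P\<close> describes this algebra; it looks only at the values on \<open>M\<close> and is stable
  under the inverse of \<open>M\<close> and under conjugation.
\<close>

locale parameter_group = M: comm_group M for M :: "complex monoid" (structure) +
  fixes P :: "(complex \<Rightarrow> complex) \<Rightarrow> bool"
  assumes cnj_closed [simp]: "z \<in> carrier M \<Longrightarrow> cnj z \<in> carrier M"
    and cnj_mult: "\<lbrakk>z \<in> carrier M; w \<in> carrier M\<rbrakk> \<Longrightarrow> cnj (z \<otimes> w) = cnj z \<otimes> cnj w"
    and P_cong: "\<lbrakk>P f; \<And>z. z \<in> carrier M \<Longrightarrow> f z = g z\<rbrakk> \<Longrightarrow> P g"
    and P_const: "P (\<lambda>_. c)"
    and P_add: "\<lbrakk>P f; P g\<rbrakk> \<Longrightarrow> P (\<lambda>z. f z + g z)"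
    and P_mult: "\<lbrakk>P f; P g\<rbrakk> \<Longrightarrow> P (\<lambda>z. f z * g z)"
    and P_inv: "P f \<Longrightarrow> P (\<lambda>z. f (inv z))"
    and P_cnj: "P f \<Longrightarrow> P (\<lambda>z. cnj (f (cnj z)))"
begin

lemma P_sum: "(\<And>a. a \<in> S \<Longrightarrow> P (f a)) \<Longrightarrow> P (\<lambda>z. \<Sum>a\<in>S. f a z)"
  by (induction S rule: infinite_finite_induct) (auto intro: P_add P_const)

lemma P_prod: "(\<And>a. a \<in> S \<Longrightarrow> P (f a)) \<Longrightarrow> P (\<lambda>z. \<Prod>a\<in>S. f a z)"
  by (induction S rule: infinite_finite_induct) (auto intro: P_mult P_const)

lemma P_det:
  assumes F: "\<And>z. z \<in> carrier M \<Longrightarrow> F z \<in> carrier_mat n n"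
    and entries: "\<And>a b. \<lbrakk>a < n; b < n\<rbrakk> \<Longrightarrow> P (\<lambda>z. F z $$ (a, b))"
  shows "P (\<lambda>z. det (F z))"
proof (rule P_cong)
  show "P (\<lambda>z. \<Sum>p\<in>{p. p permutes {0..<n}}. signof p * (\<Prod>i = 0..<n. F z $$ (i, p i)))"
    by (intro P_sum P_mult P_const P_prod entries) (auto dest: permutes_in_image)
qed (simp add: det_def'[OF F])

definition param_homs :: "nat \<Rightarrow> complex mat set \<Rightarrow> (complex \<Rightarrow> complex mat) set" where
  "param_homs n G = {\<nu> \<in> hom M (complex_points n G) \<inter> extensional (carrier M).
     \<forall>a<n. \<forall>b<n. P (\<lambda>z. \<nu> z $$ (a, b))}"

definition param_module :: "nat \<Rightarrow> complex mat set \<Rightarrow> (complex \<Rightarrow> complex mat) gamma_module" where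
  "param_module n G =
    \<lparr>carrier = param_homs n G,
     monoid.mult = (\<lambda>\<mu> \<nu>. \<lambda>z\<in>carrier M. \<mu> z * \<nu> z),
     one = (\<lambda>z\<in>carrier M. 1\<^sub>m n),
     gal = (\<lambda>\<nu>. \<lambda>z\<in>carrier M. map_mat cnj (\<nu> (cnj z)))\<rparr>"

lemma param_module_simps [simp]:
  "carrier (param_module n G) = param_homs n G"
  "monoid.mult (param_module n G) = (\<lambda>\<mu> \<nu>. \<lambda>z\<in>carrier M. \<mu> z * \<nu> z)"
  "one (param_module n G) = (\<lambda>z\<in>carrier M. 1\<^sub>m n)"
  "gal (param_module n G) = (\<lambda>\<nu>. \<lambda>z\<in>carrier M. map_mat cnj (\<nu> (cnj z)))"
  by (simp_all add: param_module_def)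

lemma param_homsI:
  assumes "\<And>z. z \<in> carrier M \<Longrightarrow> \<nu> z \<in> G"
    and "\<And>z w. \<lbrakk>z \<in> carrier M; w \<in> carrier M\<rbrakk> \<Longrightarrow> \<nu> (z \<otimes> w) = \<nu> z * \<nu> w"
    and "\<And>a b. \<lbrakk>a < n; b < n\<rbrakk> \<Longrightarrow> P (\<lambda>z. \<nu> z $$ (a, b))"
  shows "(\<lambda>z\<in>carrier M. \<nu> z) \<in> param_homs n G"
proof -
  have "P (\<lambda>z. (\<lambda>z\<in>carrier M. \<nu> z) z $$ (a, b))" if "a < n" "b < n" for a b
    by (rule P_cong[OF assms(3)[OF that]]) simp
  then show ?thesis
    using assms(1,2) by (auto simp: param_homs_def hom_def)
qed

lemma param_homs_closed: "\<lbrakk>\<nu> \<in> param_homs n G; z \<in> carrier M\<rbrakk> \<Longrightarrow> \<nu> z \<in> G"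
  by (auto simp: param_homs_def hom_def)

lemma param_homs_mult:
  "\<lbrakk>\<nu> \<in> param_homs n G; z \<in> carrier M; w \<in> carrier M\<rbrakk> \<Longrightarrow> \<nu> (z \<otimes> w) = \<nu> z * \<nu> w"
  by (auto simp: param_homs_def hom_def)

lemma param_homs_entries:
  "\<lbrakk>\<nu> \<in> param_homs n G; a < n; b < n\<rbrakk> \<Longrightarrow> P (\<lambda>z. \<nu> z $$ (a, b))"
  by (auto simp: param_homs_def)

lemma param_homs_eqI:
  "\<lbrakk>\<mu> \<in> param_homs n G; \<nu> \<in> param_homs m H; \<And>z. z \<in> carrier M \<Longrightarrow> \<mu> z = \<nu> z\<rbrakk> \<Longrightarrow> \<mu> = \<nu>"
  by (auto simp: param_homs_def intro: extensionalityI)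

lemma param_homs_one:
  assumes "group (complex_points n G)" "\<nu> \<in> param_homs n G"
  shows "\<nu> \<one> = 1\<^sub>m n"
proof -
  interpret group_hom M "complex_points n G" \<nu>
    using assms by (simp add: group_hom_def group_hom_axioms_def param_homs_def)
  show ?thesis using hom_one by simp
qed

lemma param_homs_inv:
  assumes "group (complex_points n G)" "\<nu> \<in> param_homs n G" "z \<in> carrier M"
  shows "\<nu> (inv z) * \<nu> z = 1\<^sub>m n"
  using assms param_homs_mult[OF assms(2), of "inv z" z] param_homs_one[OF assms(1,2)] by simp

text \<open>
  Algebraic homomorphisms take parameter homomorphisms to parameter homomorphisms.  The point to
  check is that \<open>1/det\<close> causes no harm: \<open>1/det(\<nu>(z)) = det(\<nu>(z\<^sup>-\<^sup>1))\<close> is a polynomial in entries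
  of \<open>\<nu>\<close> at the inverse parameter.
\<close>

lemma compose_param_homs:
  assumes f: "f \<in> alg_hom K n G m H" and G: "group (complex_points n G)" "G \<subseteq> GL n"
    and \<nu>: "\<nu> \<in> param_homs n G"
  shows "compose (carrier M) f \<nu> \<in> param_homs m H"
  unfolding compose_def
proof (rule param_homsI)
  fix a b assume ab: "a < m" "b < m"
  obtain p where p: "p \<in> regular_GL K n" and fp: "\<forall>g\<in>G. f g $$ (a, b) = p g"
    using f ab unfolding alg_hom_def by blast
  have F: "\<nu> z \<in> carrier_mat n n" "det (\<nu> z) \<noteq> 0" if "z \<in> carrier M" for z
    using param_homs_closed[OF \<nu> that] G(2) by (auto dest!: GL_D)
  have "P (\<lambda>z. inverse (det (\<nu> z)))"
  proof (rule P_cong)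
    show "P (\<lambda>z. det (\<nu> (inv z)))"
      by (rule P_inv[OF P_det]) (use F \<nu> in \<open>auto intro: param_homs_entries\<close>)
    fix z assume z: "z \<in> carrier M"
    have "det (\<nu> (inv z)) * det (\<nu> z) = 1"
      using det_mult[of "\<nu> (inv z)" n "\<nu> z"] F z by (simp add: param_homs_inv[OF G(1) \<nu> z])
    then show "det (\<nu> (inv z)) = inverse (det (\<nu> z))"
      by (metis inverse_unique mult.commute)
  qed
  note inv_det = this
  have "P (\<lambda>z. p (\<nu> z))"
    using p unfolding regular_GL_def
    by (induction rule: generated_algebra.induct)
      (auto intro: inv_det P_const P_add P_mult param_homs_entries[OF \<nu>])
  then show "P (\<lambda>z. f (\<nu> z) $$ (a, b))"
    by (rule P_cong) (use fp param_homs_closed[OF \<nu>] in auto)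
qed (use f param_homs_closed[OF \<nu>] param_homs_mult[OF \<nu>] in \<open>auto simp: alg_hom_def hom_def\<close>)

lemma param_homs_inverse:
  assumes G: "comm_group (complex_points n G)" and \<nu>: "\<nu> \<in> param_homs n G"
  shows "(\<lambda>z\<in>carrier M. \<nu> (inv z)) \<in> param_homs n G"
  by (rule param_homsI)
    (use \<nu> P_inv[OF param_homs_entries[OF \<nu>]] in
      \<open>auto simp: param_homs_closed param_homs_mult M.inv_mult\<close>)

lemma galois_module_param_module:
  assumes G: "galois_module (complex_points n G)" "G \<subseteq> GL n"
  shows "galois_module (param_module n G)"
proof -
  interpret G: galois_module "complex_points n G" by fact
  have carr: "g \<in> carrier_mat n n" if "g \<in> G" for g
    using that G(2) by (auto dest!: GL_D)
  note [simp] = param_homs_closed[where n = n and G = G] param_homs_mult[where n = n and G = G] carr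
  note G_rules = G.m_closed[simplified] G.m_assoc[simplified] G.m_comm[simplified] G.m_lcomm[simplified]
  show ?thesis
  proof (intro galois_module.intro galois_module_axioms.intro comm_groupI)
    fix \<mu> \<nu> assume "\<mu> \<in> carrier (param_module n G)" "\<nu> \<in> carrier (param_module n G)"
    then have [simp]: "\<mu> \<in> param_homs n G" "\<nu> \<in> param_homs n G" by simp_all
    show "\<mu> \<otimes>\<^bsub>param_module n G\<^esub> \<nu> \<in> carrier (param_module n G)"
    proof (simp, rule param_homsI)
      fix a b assume ab: "a < n" "b < n"
      show "P (\<lambda>z. (\<mu> z * \<nu> z) $$ (a, b))"
      proof (rule P_cong)
        show "P (\<lambda>z. \<Sum>c = 0..<n. \<mu> z $$ (a, c) * \<nu> z $$ (c, b))"
          by (intro P_sum P_mult) (auto intro!: param_homs_entries[where G = G] ab)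
        fix z assume z: "z \<in> carrier M"
        have "\<mu> z \<in> carrier_mat n n" "\<nu> z \<in> carrier_mat n n" using z by (auto intro!: carr param_homs_closed[where G = G and n = n])
        then show "(\<Sum>c = 0..<n. \<mu> z $$ (a, c) * \<nu> z $$ (c, b)) = (\<mu> z * \<nu> z) $$ (a, b)"
          using ab by (simp add: scalar_prod_def)
      qed
    qed (simp_all add: G_rules)
    show "\<mu> \<otimes>\<^bsub>param_module n G\<^esub> \<nu> = \<nu> \<otimes>\<^bsub>param_module n G\<^esub> \<mu>"
      by (simp add: G_rules cong: restrict_cong)
    show "gal (param_module n G) (\<mu> \<otimes>\<^bsub>param_module n G\<^esub> \<nu>)
      = gal (param_module n G) \<mu> \<otimes>\<^bsub>param_module n G\<^esub> gal (param_module n G) \<nu>"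
      using map_mat_cnj_mult[OF carr carr] by (simp cong: restrict_cong)
  next
    show "\<one>\<^bsub>param_module n G\<^esub> \<in> carrier (param_module n G)"
    proof (simp, rule param_homsI)
      show "P (\<lambda>z. 1\<^sub>m n $$ (a, b))" for a b by (rule P_const)
    qed (use G.one_closed in simp_all)
  next
    fix \<nu> assume "\<nu> \<in> carrier (param_module n G)"
    then have \<nu> [simp]: "\<nu> \<in> param_homs n G" by simp
    have ext: "(\<lambda>z\<in>carrier M. \<nu> z) = \<nu>"
      by (rule extensional_restrict) (use \<nu> in \<open>simp add: param_homs_def\<close>)
    show "\<one>\<^bsub>param_module n G\<^esub> \<otimes>\<^bsub>param_module n G\<^esub> \<nu> = \<nu>"
      using left_mult_one_mat[OF carr[OF param_homs_closed[OF \<nu>]]] ext by (simp cong: restrict_cong)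
    show "\<exists>\<mu>\<in>carrier (param_module n G). \<mu> \<otimes>\<^bsub>param_module n G\<^esub> \<nu> = \<one>\<^bsub>param_module n G\<^esub>"
      using param_homs_inverse[OF G.comm_group_axioms \<nu>] param_homs_inv[OF G.is_group \<nu>]
      by (intro bexI[of _ "\<lambda>z\<in>carrier M. \<nu> (inv z)"]) (simp_all cong: restrict_cong)
    show "gal (param_module n G) \<nu> \<in> carrier (param_module n G)"
    proof (simp, rule param_homsI)
      show "map_mat cnj (\<nu> (cnj z)) \<in> G" if "z \<in> carrier M" for z
        using G.gal_closed[of "\<nu> (cnj z)"] that by simp
      fix a b assume ab: "a < n" "b < n"
      show "P (\<lambda>z. map_mat cnj (\<nu> (cnj z)) $$ (a, b))"
      proof (rule P_cong[OF P_cnj[OF param_homs_entries[OF \<nu> ab]]])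
        fix z assume z: "z \<in> carrier M"
        have "\<nu> (cnj z) \<in> carrier_mat n n" using z by simp
        then show "cnj (\<nu> (cnj z) $$ (a, b)) = map_mat cnj (\<nu> (cnj z)) $$ (a, b)"
          using ab by simp
      qed
    qed (use G.gal_closed map_mat_cnj_mult[OF carr carr] in \<open>simp_all add: cnj_mult\<close>)
    show "gal (param_module n G) (gal (param_module n G) \<nu>) = \<nu>"
      using ext by (simp cong: restrict_cong)
  qed (auto simp: G_rules intro!: restrict_ext)
qed

lemma galois_morphism_param_module:
  assumes G: "galois_module (complex_points n G)" "G \<subseteq> GL n"
    and H: "galois_module (complex_points m H)" "H \<subseteq> GL m"
    and j: "j \<in> alg_hom \<real> n G m H"
  shows "galois_morphism (param_module n G) (param_module m H) (compose (carrier M) j)"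
proof -
  interpret G: galois_module "complex_points n G" by fact
  note cl [simp] = param_homs_closed[where n = n and G = G] param_homs_closed[where n = m and G = H]
  have jm: "j (g * h) = j g * j h" if "g \<in> G" "h \<in> G" for g h
    using j that by (auto simp: alg_hom_def hom_def)
  have jc: "j (map_mat cnj g) = map_mat cnj (j g)" if "g \<in> G" for g
    using alg_hom_cnj[OF j G(2) H(2) that] G.gal_closed[of g] that by simp
  show ?thesis
  proof (intro galois_morphism.intro galois_morphism_axioms.intro galois_module_param_module G H)
    show "compose (carrier M) j \<in> hom (param_module n G) (param_module m H)"
      using compose_param_homs[OF j G.is_group G(2)]
      by (auto simp: hom_def jm compose_def intro!: restrict_ext)
    show "compose (carrier M) j (gal (param_module n G) \<nu>) = gal (param_module m H) (compose (carrier M) j \<nu>)"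
      if "\<nu> \<in> carrier (param_module n G)" for \<nu>
      using that by (auto simp: jc compose_def intro!: restrict_ext)
  qed
qed

lemma inv_param_module:
  assumes G: "galois_module (complex_points n G)" "G \<subseteq> GL n" and \<nu>: "\<nu> \<in> param_homs n G"
  shows "inv\<^bsub>param_module n G\<^esub> \<nu> = (\<lambda>z\<in>carrier M. \<nu> (inv z))"
proof -
  interpret G: galois_module "complex_points n G" by fact
  interpret V: galois_module "param_module n G" by (rule galois_module_param_module[OF G])
  show ?thesis
    by (rule V.inv_equality)
      (use \<nu> param_homs_inverse[OF G.comm_group_axioms \<nu>] param_homs_inv[OF G.is_group \<nu>] in
        \<open>simp_all cong: restrict_cong\<close>)
qed

end

section \<open>Diagonal matrices and tori\<close>

definition diag_of :: "nat \<Rightarrow> (nat \<Rightarrow> complex) \<Rightarrow> complex mat" where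
  "diag_of d s = Matrix.mat d d (\<lambda>(a, b). if a = b then s a else 0)"

lemma diag_of_dim [simp]: "diag_of d s \<in> carrier_mat d d" "dim_row (diag_of d s) = d" "dim_col (diag_of d s) = d"
  by (simp_all add: diag_of_def)

lemma diag_of_entry [simp]:
  "\<lbrakk>a < d; b < d\<rbrakk> \<Longrightarrow> diag_of d s $$ (a, b) = (if a = b then s a else 0)"
  by (simp add: diag_of_def)

lemma diag_of_cong: "(\<And>a. a < d \<Longrightarrow> s a = t a) \<Longrightarrow> diag_of d s = diag_of d t"
  by (rule eq_matI) auto

lemma diag_of_mult: "diag_of d s * diag_of d t = diag_of d (\<lambda>a. s a * t a)"
proof (rule eq_matI)
  fix a b assume "a < dim_row (diag_of d (\<lambda>a. s a * t a))" "b < dim_col (diag_of d (\<lambda>a. s a * t a))"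
  then have ab: "a < d" "b < d" by simp_all
  have "(\<Sum>c = 0..<d. diag_of d s $$ (a, c) * diag_of d t $$ (c, b))
      = (\<Sum>c = 0..<d. if a = c then (if c = b then s a * t b else 0) else 0)"
    by (rule sum.cong) (use ab in auto)
  also have "\<dots> = diag_of d (\<lambda>a. s a * t a) $$ (a, b)"
    using ab by (subst sum.delta') auto
  finally show "(diag_of d s * diag_of d t) $$ (a, b) = diag_of d (\<lambda>a. s a * t a) $$ (a, b)"
    using ab by (simp add: scalar_prod_def del: diag_of_entry)
qed simp_all

lemma det_diag_of: "det (diag_of d s) = (\<Prod>a = 0..<d. s a)"
proof -
  have "det (diag_of d s) = prod_list (diag_mat (diag_of d s))"
    by (rule det_upper_triangular) (auto simp: upper_triangular_def)
  also have "\<dots> = (\<Prod>a = 0..<d. s a)"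
    by (simp add: diag_mat_def prod.distinct_set_conv_list[symmetric])
  finally show ?thesis .
qed

lemma diag_of_one: "diag_of d (\<lambda>_. 1) = 1\<^sub>m d"
  by (rule eq_matI) auto

lemma diag_of_mem_diag_torus: "diag_of d s \<in> diag_torus d \<longleftrightarrow> (\<forall>a<d. s a \<noteq> 0)"
  by (auto simp: diag_torus_def GL_def det_diag_of diagonal_mat_def)

lemma diag_torus_eq_diag_of:
  assumes "g \<in> diag_torus d"
  shows "g = diag_of d (\<lambda>a. g $$ (a, a))"
  using assms by (intro eq_matI) (auto simp: diag_torus_def GL_def diagonal_mat_def)

lemma diag_torus_entry_nonzero: "\<lbrakk>g \<in> diag_torus d; a < d\<rbrakk> \<Longrightarrow> g $$ (a, a) \<noteq> 0"
  using diag_torus_eq_diag_of diag_of_mem_diag_torus by metis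

lemma diag_torus_subset: "diag_torus d \<subseteq> GL d"
  by (auto simp: diag_torus_def)

lemma diag_torus_mult:
  assumes "g \<in> diag_torus d" "h \<in> diag_torus d"
  shows "g * h = diag_of d (\<lambda>a. g $$ (a, a) * h $$ (a, a))"
proof -
  have "g * h = diag_of d (\<lambda>a. g $$ (a, a)) * diag_of d (\<lambda>a. h $$ (a, a))"
    using assms by (intro arg_cong2[where f = "(*)"] diag_torus_eq_diag_of)
  then show ?thesis by (simp add: diag_of_mult)
qed

lemma comm_group_diag_torus: "comm_group (complex_points d (diag_torus d))"
proof (rule comm_groupI; simp only: complex_points_simps)
  fix g h assume g: "g \<in> diag_torus d" and h: "h \<in> diag_torus d"
  have gh: "g * h = diag_of d (\<lambda>a. g $$ (a, a) * h $$ (a, a))"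
    "h * g = diag_of d (\<lambda>a. g $$ (a, a) * h $$ (a, a))"
    unfolding diag_torus_mult[OF g h] diag_torus_mult[OF h g] by (rule refl, rule diag_of_cong) simp
  show "g * h \<in> diag_torus d"
    unfolding gh diag_of_mem_diag_torus using g h by (simp add: diag_torus_entry_nonzero)
  show "g * h = h * g" by (simp only: gh)
next
  show "1\<^sub>m d \<in> diag_torus d"
    by (simp add: diag_of_mem_diag_torus flip: diag_of_one)
next
  fix g assume g: "g \<in> diag_torus d"
  show "\<exists>h\<in>diag_torus d. h * g = 1\<^sub>m d"
  proof
    have "diag_of d (\<lambda>a. inverse (g $$ (a, a))) * diag_of d (\<lambda>a. g $$ (a, a)) = diag_of d (\<lambda>_. 1)"
      unfolding diag_of_mult by (rule diag_of_cong) (use g in \<open>simp add: diag_torus_entry_nonzero\<close>)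
    then show "diag_of d (\<lambda>a. inverse (g $$ (a, a))) * g = 1\<^sub>m d"
      by (simp add: diag_of_one flip: diag_torus_eq_diag_of[OF g])
    show "diag_of d (\<lambda>a. inverse (g $$ (a, a))) \<in> diag_torus d"
      using g by (simp add: diag_of_mem_diag_torus diag_torus_entry_nonzero)
  qed
qed (auto simp: diag_torus_def GL_def)

text \<open>
  Commutativity and inverses are transported from the diagonal torus, stability under conjugation
  comes from the real equations.
\<close>

lemma real_torus_galois_module:
  assumes "real_torus n T"
  shows "galois_module (complex_points n T)"
proof -
  obtain d f h where f: "f \<in> alg_hom UNIV n T d (diag_torus d)" and h: "h \<in> alg_hom UNIV d (diag_torus d) n T"
    and hf: "\<forall>t\<in>T. h (f t) = t" and R: "real_group n T"
    using assms unfolding real_torus_def by blast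
  interpret Dg: comm_group "complex_points d (diag_torus d)" by (rule comm_group_diag_torus)
  have sub: "T \<subseteq> GL n" by (rule real_group_subset[OF R])
  have carr: "t \<in> carrier_mat n n" if "t \<in> T" for t using sub that by (auto dest!: GL_D)
  have T: "subgroup T (complex_points n (GL n))" using R by (simp add: real_group_def)
  have one: "1\<^sub>m n \<in> T" using subgroup.one_closed[OF T] by simp
  have f_closed: "f t \<in> diag_torus d" and f_mult: "f (s * t) = f s * f t" if "s \<in> T" "t \<in> T" for s t
    using f that by (auto simp: alg_hom_def hom_def)
  have h_closed: "h s \<in> T" and h_mult: "h (s * t) = h s * h t" if "s \<in> diag_torus d" "t \<in> diag_torus d" for s t
    using h that by (auto simp: alg_hom_def hom_def)
  have "f (1\<^sub>m n) * f (1\<^sub>m n) = f (1\<^sub>m n)"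
    using f_mult[OF one one] by simp
  then have "f (1\<^sub>m n) = 1\<^sub>m d"
    using Dg.l_cancel_one[of "f (1\<^sub>m n)" "f (1\<^sub>m n)"] f_closed[OF one one] by simp
  then have h_one: "h (1\<^sub>m d) = 1\<^sub>m n" using hf one by metis
  show ?thesis
  proof (intro galois_module.intro galois_module_axioms.intro comm_groupI; simp only: complex_points_simps)
    fix s t assume s: "s \<in> T" and t: "t \<in> T"
    show "s * t \<in> T" using subgroup.m_closed[OF T s t] by simp
    have "h (f s * f t) = h (f t * f s)"
      using Dg.m_comm[of "f s" "f t"] f_closed[OF s s] f_closed[OF t t] by simp
    then show "s * t = t * s"
      using hf s t f_closed by (metis f_mult subgroup.m_closed[OF T, simplified])
    show "map_mat cnj (s * t) = map_mat cnj s * map_mat cnj t"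
      by (rule map_mat_cnj_mult[OF carr[OF s] carr[OF t]])
  next
    fix t assume t: "t \<in> T"
    then have ft: "f t \<in> diag_torus d" using f_closed by blast
    then obtain s where s: "s \<in> diag_torus d" "s * f t = 1\<^sub>m d"
      using Dg.l_inv_ex[of "f t"] by auto
    then have "h s * t = 1\<^sub>m n"
      using h_mult[OF s(1) ft] hf t h_one by simp
    then show "\<exists>u\<in>T. u * t = 1\<^sub>m n" using h_closed s(1) by blast
  next
    show "r * s * t = r * (s * t)" if "r \<in> T" "s \<in> T" "t \<in> T" for r s t
      using that carr by (intro assoc_mult_mat)
    show "1\<^sub>m n * t = t" if "t \<in> T" for t
      using carr[OF that] by simp
  qed (simp_all add: one real_group_cnj[OF R])
qed

section \<open>Cocharacters and one-parameter subgroups\<close>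

definition laurent :: "(complex \<Rightarrow> complex) \<Rightarrow> bool" where
  "laurent f \<longleftrightarrow> (\<exists>p \<in> generated_algebra UNIV {\<lambda>z. z, inverse}. \<forall>z \<in> carrier Gm. f z = p z)"

declare restrict_UNIV [simp]

definition additive_C :: "complex monoid" where
  "additive_C = \<lparr>carrier = UNIV, monoid.mult = (+), one = 0\<rparr>"

lemma additive_C_simps [simp]:
  "carrier additive_C = UNIV" "monoid.mult additive_C = (+)" "one additive_C = 0"
  by (simp_all add: additive_C_def)

lemma comm_group_Gm: "comm_group Gm"
proof (rule comm_groupI)
  show "\<exists>y\<in>carrier Gm. y \<otimes>\<^bsub>Gm\<^esub> x = \<one>\<^bsub>Gm\<^esub>" if "x \<in> carrier Gm" for x
    using that by (intro bexI[of _ "inverse x"]) auto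
qed auto

lemma inv_Gm: "z \<noteq> 0 \<Longrightarrow> inv\<^bsub>Gm\<^esub> z = inverse z"
  by (rule group.inv_equality[OF comm_group.axioms(2)[OF comm_group_Gm]]) simp_all

lemma comm_group_additive_C: "comm_group additive_C"
  by (rule comm_groupI) (auto intro: exI[of _ "- x" for x])

lemma inv_additive_C [simp]: "inv\<^bsub>additive_C\<^esub> z = - z"
  by (rule group.inv_equality[OF comm_group.axioms(2)[OF comm_group_additive_C]]) simp_all

interpretation Gm: parameter_group Gm laurent
proof (intro parameter_group.intro parameter_group_axioms.intro comm_group_Gm)
  have inv: "(\<lambda>z. p (inverse z)) \<in> generated_algebra UNIV {\<lambda>z. z, inverse}"
    if "p \<in> generated_algebra UNIV {\<lambda>z. z, inverse}" for p :: "complex \<Rightarrow> complex"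
    using that by (induction rule: generated_algebra.induct) (auto intro: generated_algebra.intros)
  have conj: "(\<lambda>z. cnj (p (cnj z))) \<in> generated_algebra UNIV {\<lambda>z. z, inverse}"
    if "p \<in> generated_algebra UNIV {\<lambda>z. z, inverse}" for p :: "complex \<Rightarrow> complex"
    using that by (induction rule: generated_algebra.induct) (auto intro: generated_algebra.intros)
  show "laurent (\<lambda>z. f (inv\<^bsub>Gm\<^esub> z))" if "laurent f" for f
    using that inv by (fastforce simp: laurent_def inv_Gm)
  show "laurent (\<lambda>z. cnj (f (cnj z)))" if "laurent f" for f
    using that conj by (fastforce simp: laurent_def)
  show "laurent g" if "laurent f" "\<And>z. z \<in> carrier Gm \<Longrightarrow> f z = g z" for f g
    using that by (metis laurent_def)
  show "laurent (\<lambda>z. f z + g z)" if f: "laurent f" and g: "laurent g" for f g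
  proof -
    obtain p where "p \<in> generated_algebra UNIV {\<lambda>z. z, inverse}" "\<forall>z\<in>carrier Gm. f z = p z"
      using f by (auto simp: laurent_def)
    moreover obtain q where "q \<in> generated_algebra UNIV {\<lambda>z. z, inverse}" "\<forall>z\<in>carrier Gm. g z = q z"
      using g by (auto simp: laurent_def)
    ultimately show ?thesis
      unfolding laurent_def by (intro bexI[of _ "\<lambda>z. p z + q z"] generated_algebra.add) simp_all
  qed
  show "laurent (\<lambda>z. f z * g z)" if f: "laurent f" and g: "laurent g" for f g
  proof -
    obtain p where "p \<in> generated_algebra UNIV {\<lambda>z. z, inverse}" "\<forall>z\<in>carrier Gm. f z = p z"
      using f by (auto simp: laurent_def)
    moreover obtain q where "q \<in> generated_algebra UNIV {\<lambda>z. z, inverse}" "\<forall>z\<in>carrier Gm. g z = q z"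
      using g by (auto simp: laurent_def)
    ultimately show ?thesis
      unfolding laurent_def by (intro bexI[of _ "\<lambda>z. p z * q z"] generated_algebra.mult) simp_all
  qed
  show "laurent (\<lambda>_. c)" for c
    unfolding laurent_def by (rule bexI[OF _ generated_algebra.const[of c]]) simp_all
qed auto

interpretation Ga: parameter_group additive_C "\<lambda>f. f holomorphic_on UNIV"
proof (intro parameter_group.intro parameter_group_axioms.intro comm_group_additive_C)
  show "(\<lambda>z. f (inv\<^bsub>additive_C\<^esub> z)) holomorphic_on UNIV" if "f holomorphic_on UNIV" for f
  proof -
    have "(\<lambda>z. - z :: complex) holomorphic_on UNIV" by (intro holomorphic_intros)
    from holomorphic_on_compose_gen[OF this that] show ?thesis by (simp add: o_def)
  qed
  show "(\<lambda>z. cnj (f (cnj z))) holomorphic_on UNIV" if "f holomorphic_on UNIV" for f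
    using holomorphic_on_compose_cnj_cnj[of f UNIV] that
    by (auto simp: o_def intro: holomorphic_on_subset)
  show "g holomorphic_on UNIV" if "f holomorphic_on UNIV" "\<And>z. z \<in> carrier additive_C \<Longrightarrow> f z = g z" for f g
    using that by (metis holomorphic_cong UNIV_I additive_C_simps(1))
qed (auto intro!: holomorphic_intros)

lemma cochar_module_eq: "cochar_module n T = Gm.param_module n T"
  by (simp add: cochar_module_def Gm.param_module_def cocharacters_def Gm.param_homs_def laurent_def)

lemma cochar_map_eq: "cochar_map j = compose (carrier Gm) j"
  by (rule ext) (simp add: cochar_map_def)

lemma laurent_powi: "laurent (\<lambda>z. z powi c)"
proof -
  have id: "laurent (\<lambda>z. z)" and inv: "laurent inverse"
    by (auto simp: laurent_def intro: generated_algebra.intros)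
  have pow: "laurent (\<lambda>z. z ^ m)" for m
    by (induction m) (auto intro: Gm.P_const Gm.P_mult id)
  have "laurent (\<lambda>z. inverse z ^ m)" for m
    by (induction m) (auto intro: Gm.P_const Gm.P_mult inv)
  then show ?thesis
    using pow by (cases "c \<ge> 0") (simp_all add: power_int_def)
qed

lemma laurent_exp_holomorphic:
  assumes "laurent f"
  shows "(\<lambda>z. f (exp (c * z))) holomorphic_on UNIV"
proof -
  obtain p where p: "p \<in> generated_algebra UNIV {\<lambda>z. z, inverse}" and fp: "\<forall>z\<in>carrier Gm. f z = p z"
    using assms by (auto simp: laurent_def)
  have "(\<lambda>z. p (exp (c * z))) holomorphic_on UNIV"
    using p by (induction rule: generated_algebra.induct) (auto intro!: holomorphic_intros)
  then show ?thesis using fp by simp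
qed

text \<open>
  Differentiating the functional equation gives \<open>g' = c g\<close> with \<open>c = g'(0)\<close>, so that
  \<open>g(z) exp(-cz)\<close> is constant.
\<close>

lemma holomorphic_exponential_character:
  fixes g :: "complex \<Rightarrow> complex"
  assumes hol: "g holomorphic_on UNIV" and mult: "\<And>z w. g (z + w) = g z * g w" and "g 0 = 1"
  obtains c where "\<And>z. g z = exp (c * z)"
proof -
  define c where "c = deriv g 0"
  have g': "(g has_field_derivative deriv g z) (at z)" for z
    using hol holomorphic_derivI[of g UNIV z] by simp
  have dg: "deriv g z = c * g z" for z
  proof -
    have "((\<lambda>w. g (z + w)) has_field_derivative deriv g z) (at 0)"
      using DERIV_shift[of g "deriv g z" 0 z] g'[of z] by (simp add: add.commute)
    moreover have "((\<lambda>w. g (z + w)) has_field_derivative g z * c) (at 0)"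
      unfolding mult c_def by (intro DERIV_cmult g')
    ultimately show ?thesis by (metis DERIV_unique mult.commute)
  qed
  have "((\<lambda>z. g z * exp (- (c * z))) has_field_derivative 0) (at z)" for z
    using dg[of z] by (auto intro!: derivative_eq_intros g' simp: algebra_simps)
  then obtain b where b: "\<And>z. g z * exp (- (c * z)) = b"
    using has_field_derivative_zero_constant[of UNIV "\<lambda>z. g z * exp (- (c * z))"] by auto
  have "b = 1" using b[of 0] assms(3) by simp
  then have "g z = exp (c * z)" for z
    using b[of z] by (simp add: exp_minus field_simps)
  then show ?thesis using that by blast
qed

section \<open>The exponential sequence of a torus\<close>

text \<open>
  A one-parameter subgroup is determined by its derivative at \<open>0\<close>, so this is the Lie algebra of
  the torus, in the guise in which the exponential map is evaluation at \<open>1\<close>.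
\<close>

abbreviation lie :: "nat \<Rightarrow> complex mat set \<Rightarrow> (complex \<Rightarrow> complex mat) gamma_module" where
  "lie \<equiv> Ga.param_module"

text \<open>
  The factor \<open>\<pi>i\<close>, rather than \<open>2\<pi>i\<close>, makes the value at \<open>1\<close> equal to \<open>\<nu>(-1)\<close>.
\<close>

definition iota :: "(complex \<Rightarrow> complex mat) \<Rightarrow> (complex \<Rightarrow> complex mat)" where
  "iota \<nu> = (\<lambda>z. \<nu> (exp (pi * \<i> * z)))"

lemma iota_closed:
  assumes "\<nu> \<in> Gm.param_homs n T"
  shows "iota \<nu> \<in> Ga.param_homs n T"
proof -
  have "(\<lambda>z\<in>carrier additive_C. \<nu> (exp (pi * \<i> * z))) \<in> Ga.param_homs n T"
  proof (rule Ga.param_homsI)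
    show "(\<lambda>z. \<nu> (exp (pi * \<i> * z)) $$ (a, b)) holomorphic_on UNIV" if "a < n" "b < n" for a b
      using laurent_exp_holomorphic[OF Gm.param_homs_entries[OF assms that]] .
    show "\<nu> (exp (pi * \<i> * (z \<otimes>\<^bsub>additive_C\<^esub> w))) = \<nu> (exp (pi * \<i> * z)) * \<nu> (exp (pi * \<i> * w))" for z w
      using Gm.param_homs_mult[OF assms, of "exp (pi * \<i> * z)" "exp (pi * \<i> * w)"]
      by (simp add: exp_add distrib_left)
  qed (use Gm.param_homs_closed[OF assms] in simp)
  then show ?thesis by (simp add: iota_def)
qed

lemma exp_pi_onto:
  assumes "w \<noteq> 0"
  obtains z where "exp (pi * \<i> * z) = w"
  using exp_Ln[OF assms] that[of "Ln w / (pi * \<i>)"] by simp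

text \<open>
  On diagonal matrices one takes logarithms of the entries.
\<close>

lemma real_torus_exp_onto:
  assumes "real_torus n T" "t \<in> T"
  obtains \<phi> where "\<phi> \<in> Ga.param_homs n T" "\<phi> 1 = t"
proof -
  obtain d f h where f: "f \<in> alg_hom UNIV n T d (diag_torus d)" and h: "h \<in> alg_hom UNIV d (diag_torus d) n T"
    and hf: "\<forall>t\<in>T. h (f t) = t"
    using assms(1) unfolding real_torus_def by blast
  have ft: "f t \<in> diag_torus d" using f assms(2) by (auto simp: alg_hom_def hom_def)
  define v where "v = (\<lambda>a. Ln (f t $$ (a, a)))"
  define \<psi> where "\<psi> = (\<lambda>z\<in>carrier additive_C. diag_of d (\<lambda>a. exp (v a * z)))"
  have "\<psi> \<in> Ga.param_homs d (diag_torus d)"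
    unfolding \<psi>_def
  proof (rule Ga.param_homsI)
    show "(\<lambda>z. diag_of d (\<lambda>a. exp (v a * z)) $$ (a, b)) holomorphic_on UNIV" if "a < d" "b < d" for a b
      using that by (cases "a = b") (auto intro!: holomorphic_intros)
  qed (simp_all add: diag_of_mem_diag_torus diag_of_mult exp_add distrib_left)
  then have "compose (carrier additive_C) h \<psi> \<in> Ga.param_homs n T"
    by (rule Ga.compose_param_homs[OF h comm_group.axioms(2)[OF comm_group_diag_torus] diag_torus_subset])
  moreover have "\<psi> 1 = f t"
    by (subst diag_torus_eq_diag_of[OF ft])
      (use ft in \<open>auto simp: \<psi>_def v_def diag_torus_entry_nonzero intro!: diag_of_cong\<close>)
  then have "compose (carrier additive_C) h \<psi> 1 = t"
    using hf assms(2) by (simp add: compose_def)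
  ultimately show ?thesis using that by blast
qed

text \<open>
  The diagonal entries of \<open>\<phi>\<close>, seen in the diagonal torus, are functions \<open>exp(cz)\<close> with
  \<open>exp(c) = 1\<close>; so \<open>c = 2\<pi>ik\<close>, and the entry is the \<open>k\<close>-th power of \<open>exp(2\<pi>iz)\<close>.  The powers
  are the entries of an algebraic cocharacter.
\<close>

lemma real_torus_exp_kernel:
  assumes T: "real_torus n T" and \<phi>: "\<phi> \<in> Ga.param_homs n T" "\<phi> 1 = 1\<^sub>m n"
  obtains \<nu> where "\<nu> \<in> Gm.param_homs n T" "\<And>z. \<phi> z = \<nu> (exp (2 * pi * \<i> * z))"
proof -
  obtain d f h where f: "f \<in> alg_hom UNIV n T d (diag_torus d)" and h: "h \<in> alg_hom UNIV d (diag_torus d) n T"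
    and hf: "\<forall>t\<in>T. h (f t) = t"
    using T unfolding real_torus_def by blast
  interpret T: galois_module "complex_points n T" by (rule real_torus_galois_module[OF T])
  interpret Dg: comm_group "complex_points d (diag_torus d)" by (rule comm_group_diag_torus)
  have sub: "T \<subseteq> GL n" using T real_group_subset by (auto simp: real_torus_def)
  interpret f: group_hom "complex_points n T" "complex_points d (diag_torus d)" f
    using f by unfold_locales (simp add: alg_hom_def)
  define \<psi> where "\<psi> = compose (carrier additive_C) f \<phi>"
  have \<psi>: "\<psi> \<in> Ga.param_homs d (diag_torus d)"
    unfolding \<psi>_def by (rule Ga.compose_param_homs[OF f T.is_group sub \<phi>(1)])
  have \<psi>_closed: "\<psi> z \<in> diag_torus d" for z
    using Ga.param_homs_closed[OF \<psi>] by simp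
  have \<psi>_one: "\<psi> 1 = 1\<^sub>m d"
    using f.hom_one \<phi>(2) by (simp add: \<psi>_def compose_def)
  have "\<exists>c::int. \<forall>z. \<psi> z $$ (a, a) = exp (2 * pi * \<i> * z) powi c" if a: "a < d" for a
  proof -
    obtain c where c: "\<And>z. \<psi> z $$ (a, a) = exp (c * z)"
    proof (rule holomorphic_exponential_character)
      show "(\<lambda>z. \<psi> z $$ (a, a)) holomorphic_on UNIV"
        by (rule Ga.param_homs_entries[OF \<psi> a a])
      show "\<psi> (z + w) $$ (a, a) = \<psi> z $$ (a, a) * \<psi> w $$ (a, a)" for z w
        using Ga.param_homs_mult[OF \<psi>, of z w] by (simp add: diag_torus_mult[OF \<psi>_closed \<psi>_closed] a)
      show "\<psi> 0 $$ (a, a) = 1"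
        using Ga.param_homs_one[OF Dg.is_group \<psi>] a by simp
    qed blast
    have "exp c = 1" using c[of 1] \<psi>_one a by simp
    then obtain k where "c = of_int (2 * k) * (of_real pi * \<i>)"
      using complex_eq_iff exp_eq_1[of c] by fastforce
    then have k: "c * z = of_int k * (2 * pi * \<i> * z)" for z by simp
    have "\<psi> z $$ (a, a) = exp (2 * pi * \<i> * z) powi k" for z
      by (simp add: c k exp_power_int)
    then show ?thesis by blast
  qed
  then obtain e :: "nat \<Rightarrow> int" where e: "\<And>a z. a < d \<Longrightarrow> \<psi> z $$ (a, a) = exp (2 * pi * \<i> * z) powi e a"
    by metis
  define \<mu> where "\<mu> = (\<lambda>z\<in>carrier Gm. diag_of d (\<lambda>a. z powi e a))"
  have \<mu>: "\<mu> \<in> Gm.param_homs d (diag_torus d)"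
    unfolding \<mu>_def
  proof (rule Gm.param_homsI)
    show "laurent (\<lambda>z. diag_of d (\<lambda>a. z powi e a) $$ (a, b))" if "a < d" "b < d" for a b
      using that by (cases "a = b") (simp_all add: laurent_powi Gm.P_const)
  qed (simp_all add: diag_of_mem_diag_torus diag_of_mult power_int_mult_distrib)
  have \<psi>\<mu>: "\<psi> z = \<mu> (exp (2 * pi * \<i> * z))" for z
    by (subst diag_torus_eq_diag_of[OF \<psi>_closed]) (auto simp: \<mu>_def e intro!: diag_of_cong)
  show ?thesis
  proof
    show "compose (carrier Gm) h \<mu> \<in> Gm.param_homs n T"
      by (rule Gm.compose_param_homs[OF h Dg.is_group diag_torus_subset \<mu>])
    have "\<phi> z = h (\<psi> z)" for z
      using hf Ga.param_homs_closed[OF \<phi>(1), of z] by (simp add: \<psi>_def compose_def)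
    then show "\<phi> z = compose (carrier Gm) h \<mu> (exp (2 * pi * \<i> * z))" for z
      by (simp add: \<psi>\<mu> compose_def)
  qed
qed

text \<open>
  Torsion-freeness and halving come from rescaling: \<open>\<phi>(z) = \<phi>(z/2)\<^sup>2\<close>.  The Galois relation holds
  because the conjugate of \<open>exp(-\<pi>iz)\<close> is \<open>exp(\<pi>i cnj z)\<close>.
\<close>

lemma real_torus_exponential_sequence:
  assumes T: "real_torus n T"
  shows "exponential_sequence (complex_points n T) (cochar_module n T) (lie n T) iota (\<lambda>\<phi>. \<phi> 1)"
proof -
  interpret T: galois_module "complex_points n T" by (rule real_torus_galois_module[OF T])
  have sub: "T \<subseteq> GL n" using T real_group_subset by (auto simp: real_torus_def)
  note cl = Ga.param_homs_closed[of _ n T, simplified]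
  note mult = Ga.param_homs_mult[of _ n T, simplified]
  have carr: "t \<in> carrier_mat n n" if "t \<in> T" for t using sub that by (auto dest!: GL_D)
  show ?thesis
    unfolding cochar_module_eq
  proof (intro exponential_sequence.intro exponential_sequence_axioms.intro
      Gm.galois_module_param_module Ga.galois_module_param_module T.galois_module_axioms sub)
    show "iota \<in> hom (Gm.param_module n T) (lie n T)"
      by (auto simp: hom_def iota_closed) (simp add: iota_def)
    show "\<mu> = \<nu>" if mn: "\<mu> \<in> carrier (Gm.param_module n T)" "\<nu> \<in> carrier (Gm.param_module n T)"
      and eq: "iota \<mu> = iota \<nu>" for \<mu> \<nu>
    proof (rule Gm.param_homs_eqI)
      fix w assume "w \<in> carrier Gm"
      then obtain z where "exp (pi * \<i> * z) = w" using exp_pi_onto[of w] by auto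
      then show "\<mu> w = \<nu> w" using fun_cong[OF eq, of z] by (simp add: iota_def)
    qed (use mn in simp_all)
    show "gal (lie n T) (iota \<nu>) = inv\<^bsub>lie n T\<^esub> iota (gal (Gm.param_module n T) \<nu>)"
      if "\<nu> \<in> carrier (Gm.param_module n T)" for \<nu>
    proof -
      interpret X: galois_module "Gm.param_module n T"
        by (rule Gm.galois_module_param_module[OF T.galois_module_axioms sub])
      have "inv\<^bsub>lie n T\<^esub> iota (gal (Gm.param_module n T) \<nu>)
          = (\<lambda>z. iota (gal (Gm.param_module n T) \<nu>) (- z))"
        using Ga.inv_param_module[OF T.galois_module_axioms sub, of "iota (gal (Gm.param_module n T) \<nu>)"]
          iota_closed[of "gal (Gm.param_module n T) \<nu>"] X.gal_closed[OF that] by simp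
      then show ?thesis
        by (simp add: iota_def exp_cnj)
    qed
    show "(\<lambda>\<phi>. \<phi> 1) \<in> hom (lie n T) (complex_points n T)"
      by (auto simp: hom_def cl)
    show "gal (lie n T) \<phi> 1 = gal (complex_points n T) (\<phi> 1)" for \<phi>
      by simp
    show "\<exists>\<phi>\<in>carrier (lie n T). \<phi> 1 = t" if "t \<in> carrier (complex_points n T)" for t
      using real_torus_exp_onto[OF T, of t] that by auto
    show "iota \<nu> 1 \<otimes>\<^bsub>complex_points n T\<^esub> iota \<nu> 1 = \<one>\<^bsub>complex_points n T\<^esub>"
      if "\<nu> \<in> carrier (Gm.param_module n T)" for \<nu>
      using that Gm.param_homs_mult[of \<nu> n T "-1" "-1"] Gm.param_homs_one[OF T.is_group, of \<nu>]
      by (simp add: iota_def)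
    show "\<exists>\<nu>\<in>carrier (Gm.param_module n T). \<phi> = iota \<nu> \<otimes>\<^bsub>lie n T\<^esub> iota \<nu>"
      if \<phi>: "\<phi> \<in> carrier (lie n T)" "\<phi> 1 = \<one>\<^bsub>complex_points n T\<^esub>" for \<phi>
    proof -
      obtain \<nu> where \<nu>: "\<nu> \<in> Gm.param_homs n T" and eq: "\<And>z. \<phi> z = \<nu> (exp (2 * pi * \<i> * z))"
        using real_torus_exp_kernel[OF T, of \<phi>] \<phi> by auto
      have "\<phi> z = iota \<nu> z * iota \<nu> z" for z
      proof -
        have "exp (2 * pi * \<i> * z) = exp (pi * \<i> * z) * exp (pi * \<i> * z)"
          unfolding exp_add[symmetric] by (simp add: algebra_simps)
        then show ?thesis
          using Gm.param_homs_mult[OF \<nu>, of "exp (pi * \<i> * z)" "exp (pi * \<i> * z)"]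
          by (simp add: eq iota_def)
      qed
      then show ?thesis using \<nu> by (intro bexI[of _ \<nu>]) auto
    qed
    show "\<phi> = \<one>\<^bsub>lie n T\<^esub>"
      if "\<phi> \<in> carrier (lie n T)" "\<phi> \<otimes>\<^bsub>lie n T\<^esub> \<phi> = \<one>\<^bsub>lie n T\<^esub>" for \<phi>
    proof
      fix z
      show "\<phi> z = \<one>\<^bsub>lie n T\<^esub> z"
        using mult[of \<phi> "z / 2" "z / 2"] fun_cong[OF that(2), of "z / 2"] that(1) by simp
    qed
    show "\<exists>\<psi>\<in>carrier (lie n T). \<psi> \<otimes>\<^bsub>lie n T\<^esub> \<psi> = \<phi>" if "\<phi> \<in> carrier (lie n T)" for \<phi>
    proof
      have \<phi>: "\<phi> \<in> Ga.param_homs n T" using that by simp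
      have "(\<lambda>z\<in>carrier additive_C. \<phi> (z / 2)) \<in> Ga.param_homs n T"
      proof (rule Ga.param_homsI)
        show "(\<lambda>z. \<phi> (z / 2) $$ (a, b)) holomorphic_on UNIV" if "a < n" "b < n" for a b
        proof -
          have "(\<lambda>z::complex. z / 2) holomorphic_on UNIV" by (intro holomorphic_intros) simp
          from holomorphic_on_compose_gen[OF this Ga.param_homs_entries[OF \<phi> that]]
          show ?thesis by (simp add: o_def)
        qed
      qed (use \<phi> in \<open>auto simp: cl mult add_divide_distrib\<close>)
      then show "(\<lambda>z. \<phi> (z / 2)) \<in> carrier (lie n T)" by simp
      show "(\<lambda>z. \<phi> (z / 2)) \<otimes>\<^bsub>lie n T\<^esub> (\<lambda>z. \<phi> (z / 2)) = \<phi>"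
        using mult[OF \<phi>, of "_ / 2" "_ / 2"] by (simp flip: mult[OF \<phi>])
    qed
  qed
qed

lemma real_torus_exponential_morphism:
  assumes T: "real_torus n T" and T': "real_torus m T'"
    and j: "j \<in> alg_hom \<real> n T m T'" and onto: "j ` T = T'"
  shows "exponential_morphism (complex_points n T) (cochar_module n T) (lie n T) iota (\<lambda>\<phi>. \<phi> 1)
    (complex_points m T') (cochar_module m T') (lie m T') iota (\<lambda>\<phi>. \<phi> 1)
    j (cochar_map j) (compose UNIV j)"
proof -
  interpret T: galois_module "complex_points n T" by (rule real_torus_galois_module[OF T])
  interpret T': galois_module "complex_points m T'" by (rule real_torus_galois_module[OF T'])
  have sub: "T \<subseteq> GL n" "T' \<subseteq> GL m"
    using T T' real_group_subset by (auto simp: real_torus_def)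
  have "galois_morphism (complex_points n T) (complex_points m T') j"
    using j alg_hom_cnj[OF j sub] T.gal_closed
    by (intro galois_morphism.intro galois_morphism_axioms.intro T.galois_module_axioms
        T'.galois_module_axioms) (simp_all add: alg_hom_def)
  then show ?thesis
    using real_torus_exponential_sequence[OF T] real_torus_exponential_sequence[OF T']
      Gm.galois_morphism_param_module[OF T.galois_module_axioms sub(1) T'.galois_module_axioms sub(2) j]
      Ga.galois_morphism_param_module[OF T.galois_module_axioms sub(1) T'.galois_module_axioms sub(2) j]
    by (intro exponential_morphism.intro exponential_morphism_axioms.intro)
      (simp_all add: cochar_module_eq cochar_map_eq onto compose_def iota_def)
qed

theorem theorem3p15:
  fixes n m :: nat
    and T T' A :: "complex mat set"
    and j :: "complex mat \<Rightarrow> complex mat"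
    and k :: int
  assumes "real_torus n T"
    and "real_torus m T'"
    and "j \<in> alg_hom \<real> n T m T'"
    and "j ` T = T'"
    and "real_quasi_torus n A"
    and "A = kernel (complex_points n T) (complex_points m T') j"
  shows "\<exists>\<theta> \<in> iso (hypercohomology (cochar_module n T) (cochar_module m T') (cochar_map j) k)
                 (tate_cohomology (complex_points n A) (k + 1)).
           \<forall>\<nu> \<nu>' t.
             (\<nu>, \<nu>') \<in> hypercocycles (cochar_module n T) (cochar_module m T') (cochar_map j) k \<longrightarrow>
             t \<in> T \<longrightarrow> j t = \<nu>' (- 1) \<longrightarrow>
               theta_value (complex_points n T) k \<nu> t
                 \<in> tate_cocycles (complex_points n A) (k + 1) \<and>
               \<theta> (hyper_class (cochar_module n T) (cochar_module m T') (cochar_map j) k (\<nu>, \<nu>'))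
                 = tate_class (complex_points n A) (k + 1)
                     (theta_value (complex_points n T) k \<nu> t)"
proof -
  interpret exponential_morphism "complex_points n T" "cochar_module n T" "lie n T" iota "\<lambda>\<phi>. \<phi> 1"
    "complex_points m T'" "cochar_module m T'" "lie m T'" iota "\<lambda>\<phi>. \<phi> 1" j "cochar_map j" "compose UNIV j"
    by (rule real_torus_exponential_morphism[OF assms(1-4)])
  have A_eq: "complex_points n T\<lparr>carrier := kernel (complex_points n T) (complex_points m T') j\<rparr>
      = complex_points n A"
    by (simp add: complex_points_def assms(6))
  have sign: "S.sign_point \<nu> = \<nu> (- 1)" "S'.sign_point \<nu> = \<nu> (- 1)" for \<nu>
    by (simp_all add: S.sign_point_def S'.sign_point_def iota_def)
  have theta: "theta k \<nu> t = theta_value (complex_points n T) k \<nu> t" for \<nu> t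
    by (simp add: theta_def theta_value_def sign sign_power_def)
  show ?thesis
    using theta_iso[of k] unfolding A_eq sign theta by simp
qed

end
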